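(* Let $b,p,c\in\mathbb{C}$ with $c\neq0$ and $\kappa=p+\frac{b+1}{2}\notin\{0,-1,-2,\dots\}$, let $f,g_1,g_2\in\mathcal{A}$, and let $\omega_i(z)=B_{\kappa,c}(g_i)(z)/z$ for $i=1,2$. Suppose that $\mu>-1$ and that for $i=1,2$ and all $z\in\mathbb{D}$ $$\operatorname{Re}\left(\frac{z\omega_i''(z)}{\omega_i'(z)}+1\right)>-\gamma_\mu,\qquad \gamma_\mu=\frac{1+(\mu+1)^2-\sqrt{1+(\mu+1)^4}}{4(\mu+1)}.$$ If $z\mapsto B_{\kappa,c}(f)(z)/z$ is univalent in $\mathbb{D}$ and the function $z\mapsto B_{\kappa,c}(F_\mu(f))(z)/z$ belongs to $\mathcal{H}[1,1]\cap Q$, then $$\omega_1(z)\prec\frac{B_{\kappa,c}(f)(z)}{z}\prec\omega_2(z)$$ implies that $$\frac{B_{\kappa,c}(F_\mu(g_1))(z)}{z}\prec\frac{B_{\kappa,c}(F_\mu(f))(z)}{z}\prec\frac{B_{\kappa,c}(F_\mu(g_2))(z)}{z}.$$ Moreover, the function $z\mapsto B_{\kappa,c}(F_\mu(g_1))(z)/z$ is the best subordinant of the differential superordination $\omega_1(z)\prec P(z)+\frac{1}{\mu+1}zP'(z)$, and the function $z\mapsto B_{\kappa,c}(F_\mu(g_2))(z)/z$ is the best dominant of the differential subordination $P(z)+\frac{1}{\mu+1}zP'(z)\prec\omega_2(z)$.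
   Context: $\mathbb{D}=\{z\in\mathbb{C}:|z|<1\}$. $\mathcal{A}$ is the class of functions $f(z)=z+\sum_{n\ge1}a_{n+1}z^{n+1}$ that are analytic and univalent (injective) in $\mathbb{D}$. $\mathcal{H}[1,1]$ is the class of analytic functions in $\mathbb{D}$ of the form $1+a_1z+a_2z^2+\dots$. For $\nu\in\mathbb{C}\setminus\{0,-1,-2,\dots\}$ and $c\in\mathbb{C}\setminus\{0\}$, and $f(z)=z+\sum_{n\ge1}a_{n+1}z^{n+1}$ analytic in $\mathbb{D}$, define $$B_{\nu,c}(f)(z)=z+\sum_{n\ge1}a_{n+1}\frac{(-c/4)^n}{(\nu)_n}\frac{z^{n+1}}{n!},\qquad (\nu)_n=\nu(\nu+1)\cdots(\nu+n-1).$$ Expressions such as $B_{\nu,c}(f)(z)/z$ are understood to be extended analytically to $z=0$ (with value $1$). Generalized Libera integral operator: for real $\mu>-1$ and $f\in\mathcal{A}$, $$F_\mu(f)(z)=\frac{\mu+1}{z^\mu}\int_0^z t^{\mu-1}f(t)\,dt,$$ interpreted along the segment from $0$ to $z$ with matching branches of the powers, i.e. $F_\mu(f)(z)=(\mu+1)\int_0^1 s^{\mu-1}f(sz)\,ds$; it is analytic in $\mathbb{D}$ and of the form $z+\dots$. Subordination: for $f,F$ analytic in $\mathbb{D}$, $f\prec F$ means there is $w$ analytic in $\mathbb{D}$ with $|w(z)|\le|z|$ and $f(z)=F(w(z))$ for all $z\in\mathbb{D}$. $Q$ is the class of functions $f$ that are analytic and injective on $\overline{\mathbb{D}}\setminus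 E(f)$, where $E(f)=\{\zeta\in\partial\mathbb{D}:\lim_{z\to\zeta}f(z)=\infty\}$, and such that $f'(\zeta)\ne0$ for $\zeta\in\partial\mathbb{D}\setminus E(f)$. Best dominant: let $\varphi:\mathbb{C}^2\to\mathbb{C}$ and let $h$ be univalent in $\mathbb{D}$. A solution of the differential subordination $\varphi(P(z),zP'(z))\prec h(z)$ is an analytic function $P$ in $\mathbb{D}$ satisfying it. A univalent function $q$ is a dominant if $P\prec q$ for all solutions $P$. A dominant $\tilde q$ with $\tilde q\prec q$ for all dominants $q$ is the best dominant. Best subordinant: let $h$ be analytic in $\mathbb{D}$. A solution of the differential superordination $h(z)\prec\varphi(P(z),zP'(z))$ is a function $P$ such that $P$ and $z\mapsto\varphi(P(z),zP'(z))$ are univalent in $\mathbb{D}$ and satisfy it. An analytic function $q$ is a subordinant if $q\prec P$ for all solutions $P$. A univalent subordinant $\tilde q$ with $q\prec\tilde q$ for all subordinants $q$ is the best subordinant. (Here $\varphi(u,v)=u+\frac{1}{\mu+1}v$.) The hypotheses on $z\omega_i''(z)/\omega_i'(z)$ are understood to include that $\omega_i'(z)\ne0$ in $\mathbb{D}$, so that the quotients are defined. *)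

theory Defs
  imports "HOL-Complex_Analysis.Complex_Analysis" "HOL-Library.Nonpos_Ints"
begin

abbreviation unit_disc :: "complex set" ("\<D>") where
  "\<D> \<equiv> ball 0 1"

definition univalent :: "(complex \<Rightarrow> complex) \<Rightarrow> bool" where
  "univalent f \<longleftrightarrow> f holomorphic_on \<D> \<and> inj_on f \<D>"

definition class_A :: "(complex \<Rightarrow> complex) set" where
  "class_A = {f. univalent f \<and> f 0 = 0 \<and> deriv f 0 = 1}"

definition class_H11 :: "(complex \<Rightarrow> complex) set" where
  "class_H11 = {f. f holomorphic_on \<D> \<and> f 0 = 1}"

definition exceptional_set :: "(complex \<Rightarrow> complex) \<Rightarrow> complex set" where
  "exceptional_set f = {\<zeta> \<in> sphere 0 1. filterlim f at_infinity (at \<zeta> within \<D>)}"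

(* The functions here are total, so membership refers to their actual values on the unit circle.
   The series defining bessel_op converges on the whole plane when f is holomorphic on the unit
   disc, so bessel_op \<nu> c f and quot_id (bessel_op \<nu> c f) carry the right values there. *)
definition class_Q :: "(complex \<Rightarrow> complex) set" where
  "class_Q = {f. f analytic_on (cball 0 1 - exceptional_set f) \<and>
                 inj_on f (cball 0 1 - exceptional_set f) \<and>
                 (\<forall>\<zeta> \<in> sphere 0 1 - exceptional_set f. deriv f \<zeta> \<noteq> 0)}"

(* The summation index is n = m + 1 with m ranging over all naturals. *)
definition bessel_op :: "complex \<Rightarrow> complex \<Rightarrow> (complex \<Rightarrow> complex) \<Rightarrow> complex \<Rightarrow> complex" where
  "bessel_op \<nu> c f z =
     z + (\<Sum>m. fps_nth (fps_expansion f 0) (m + 2)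
               * ((- c / 4) ^ (m + 1) / pochhammer \<nu> (m + 1)) * (z ^ (m + 2) / fact (m + 1)))"

(* f(z)/z, with the removable singularity filled in for f normalized by f(0) = 0, f'(0) = 1 *)
definition quot_id :: "(complex \<Rightarrow> complex) \<Rightarrow> complex \<Rightarrow> complex" where
  "quot_id f z = (if z = 0 then 1 else f z / z)"

definition libera_op :: "real \<Rightarrow> (complex \<Rightarrow> complex) \<Rightarrow> complex \<Rightarrow> complex" where
  "libera_op \<mu> f z =
     of_real (\<mu> + 1) * integral {0..1} (\<lambda>s::real. of_real (s powr (\<mu> - 1)) * f (of_real s * z))"

definition subordinate :: "(complex \<Rightarrow> complex) \<Rightarrow> (complex \<Rightarrow> complex) \<Rightarrow> bool"
    (infix "\<prec>" 50) where
  "f \<prec> F \<longleftrightarrow> f holomorphic_on \<D> \<and> F holomorphic_on \<D> \<and>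
     (\<exists>w. w holomorphic_on \<D> \<and> (\<forall>z\<in>\<D>. norm (w z) \<le> norm z \<and> f z = F (w z)))"

definition diff_expr ::
  "(complex \<Rightarrow> complex \<Rightarrow> complex) \<Rightarrow> (complex \<Rightarrow> complex) \<Rightarrow> complex \<Rightarrow> complex" where
  "diff_expr \<phi> P z = \<phi> (P z) (z * deriv P z)"

definition subordination_solution ::
  "(complex \<Rightarrow> complex \<Rightarrow> complex) \<Rightarrow> (complex \<Rightarrow> complex) \<Rightarrow> (complex \<Rightarrow> complex) \<Rightarrow> bool" where
  "subordination_solution \<phi> h P \<longleftrightarrow> P holomorphic_on \<D> \<and> diff_expr \<phi> P \<prec> h"

definition dominant ::
  "(complex \<Rightarrow> complex \<Rightarrow> complex) \<Rightarrow> (complex \<Rightarrow> complex) \<Rightarrow> (complex \<Rightarrow> complex) \<Rightarrow> bool" where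
  "dominant \<phi> h q \<longleftrightarrow> univalent q \<and> (\<forall>P. subordination_solution \<phi> h P \<longrightarrow> P \<prec> q)"

definition best_dominant ::
  "(complex \<Rightarrow> complex \<Rightarrow> complex) \<Rightarrow> (complex \<Rightarrow> complex) \<Rightarrow> (complex \<Rightarrow> complex) \<Rightarrow> bool" where
  "best_dominant \<phi> h q \<longleftrightarrow>
     univalent h \<and> dominant \<phi> h q \<and> (\<forall>q'. dominant \<phi> h q' \<longrightarrow> q \<prec> q')"

definition superordination_solution ::
  "(complex \<Rightarrow> complex \<Rightarrow> complex) \<Rightarrow> (complex \<Rightarrow> complex) \<Rightarrow> (complex \<Rightarrow> complex) \<Rightarrow> bool" where
  "superordination_solution \<phi> h P \<longleftrightarrow>
     univalent P \<and> univalent (diff_expr \<phi> P) \<and> h \<prec> diff_expr \<phi> P"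

definition subordinant ::
  "(complex \<Rightarrow> complex \<Rightarrow> complex) \<Rightarrow> (complex \<Rightarrow> complex) \<Rightarrow> (complex \<Rightarrow> complex) \<Rightarrow> bool" where
  "subordinant \<phi> h q \<longleftrightarrow>
     q holomorphic_on \<D> \<and> (\<forall>P. superordination_solution \<phi> h P \<longrightarrow> q \<prec> P)"

definition best_subordinant ::
  "(complex \<Rightarrow> complex \<Rightarrow> complex) \<Rightarrow> (complex \<Rightarrow> complex) \<Rightarrow> (complex \<Rightarrow> complex) \<Rightarrow> bool" where
  "best_subordinant \<phi> h q \<longleftrightarrow>
     h holomorphic_on \<D> \<and> univalent q \<and> subordinant \<phi> h q \<and>
     (\<forall>q'. subordinant \<phi> h q' \<longrightarrow> q' \<prec> q)"

definition gamma_bound :: "real \<Rightarrow> real" where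
  "gamma_bound \<mu> = (1 + (\<mu> + 1)^2 - sqrt (1 + (\<mu> + 1)^4)) / (4 * (\<mu> + 1))"

end

theory Submission
  imports Defs
begin

text \<open>Put \<open>\<beta> = \<mu> + 1\<close>. On Taylor coefficients both operators are multipliers, so
  \<open>\<omega> = B(g)/z\<close> and \<open>q = B(F(g))/z\<close> satisfy \<open>\<omega> = q + z q' / \<beta>\<close>, and \<open>Q = 1 + z q'' / q'\<close> satisfies
  \<open>Q + z Q' / (Q + \<beta>) = 1 + z \<omega>'' / \<omega>'\<close>. A boundary Schwarz lemma turns the hypothesis on \<open>\<omega>\<close>
  into \<open>Re Q > 0\<close>, i.e. \<open>q\<close> is a convex map. For such \<open>q\<close> the functions
  \<open>L(z,t) = q + t z q'\<close>, \<open>t \<ge> 0\<close>, are injective and form a subordination chain in \<open>t\<close>.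

  If \<open>P\<close> is not subordinate to \<open>q\<close>, then Jack's lemma gives a first contact \<open>P(z) = q(\<zeta>)\<close>,
  \<open>|z| < |\<zeta>|\<close>, \<open>z P'(z) = m \<zeta> q'(\<zeta>)\<close> with \<open>m \<ge> 1\<close>, so that \<open>P + z P' / \<beta>\<close> takes the value \<open>L(\<zeta>, m/\<beta>)\<close>
  at \<open>z\<close>. This value is also \<open>L(v, 1/\<beta>)\<close> for some \<open>|v| \<le> |z|\<close>, hence \<open>L(v', m/\<beta>)\<close> with
  \<open>|v'| < |\<zeta>|\<close>, against injectivity. Superordination is the same argument with the roles of
  \<open>P\<close> and \<open>q\<close> exchanged and the parameter \<open>1/(m\<beta>) \<le> 1/\<beta>\<close>; it needs no boundary behaviour of \<open>P\<close>,
  because the contact occurs inside the disc. Since \<open>q\<close> itself solves the equation, it is the best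
  dominant and the best subordinant.\<close>

subsection \<open>Boundary extrema\<close>

text \<open>The maximum over the closed disc is two-sided along the circle t -> z e^(it), so the
  tangential derivative, -Im (z h'), vanishes. Along the radius only inner points compete, which
  leaves a sign for Re (z h').\<close>

lemma boundary_max_Re:
  fixes h :: "complex \<Rightarrow> complex"
  assumes h: "(h has_field_derivative h') (at z)"
    and max: "\<And>x. norm x \<le> norm z \<Longrightarrow> Re (h x) \<le> Re (h z)"
  shows "Im (z * h') = 0" and "Re (z * h') \<ge> 0"
proof -
  have "((\<lambda>x. h (z * exp (\<i> * x))) has_field_derivative h' * (z * \<i>)) (at (of_real 0))"
    by (rule DERIV_chain'[where g = h]) (use h in \<open>auto intro!: derivative_eq_intros\<close>)
  then have "((\<lambda>t. h (z * cis t)) has_vector_derivative h' * (z * \<i>)) (at 0)"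
    unfolding cis_conv_exp by (rule has_vector_derivative_real_field)
  then have "((\<lambda>t. Re (h (z * cis t))) has_real_derivative Re (h' * (z * \<i>))) (at 0)"
    by (rule has_field_derivative_Re)
  then have "Re (h' * (z * \<i>)) = 0"
    by (rule DERIV_local_max[where d = 1]) (auto simp: norm_mult intro!: max)
  then show "Im (z * h') = 0"
    by (simp add: algebra_simps)
  have "((\<lambda>x. h (z * x)) has_field_derivative h' * z) (at (of_real 1))"
    by (rule DERIV_chain'[where g = h]) (use h in \<open>auto intro!: derivative_eq_intros\<close>)
  then have "((\<lambda>t::real. h (z * of_real t)) has_vector_derivative h' * z) (at 1)"
    by (rule has_vector_derivative_real_field)
  then have D: "((\<lambda>t::real. Re (h (z * of_real t))) has_real_derivative Re (h' * z)) (at 1)"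
    by (rule has_field_derivative_Re)
  show "Re (z * h') \<ge> 0"
  proof (rule ccontr)
    assume "\<not> Re (z * h') \<ge> 0"
    then obtain d where d: "d > 0" "\<And>t. 0 < t \<Longrightarrow> t < d \<Longrightarrow> Re (h (z * of_real 1)) < Re (h (z * of_real (1 - t)))"
      using DERIV_neg_dec_left[OF D] by (auto simp: mult.commute)
    \<comment> \<open>The cap at 1 keeps the factor 1 - t in [0,1], so the scaled point stays in the
      closed disc where \<open>max\<close> applies.\<close>
    define t where "t = min (d/2) 1"
    have t: "0 < t" "t < d" using d(1) by (auto simp: t_def)
    have "norm (z * of_real (1 - t)) \<le> norm z"
      unfolding norm_mult norm_of_real using d(1) by (intro mult_left_le) (auto simp: t_def)
    then show False
      using max[of "z * of_real (1 - t)"] d(2)[OF t] by simp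
  qed
qed

text \<open>The set where \<phi> is nonnegative is compact inside the closed disc of radius |z1|, so
  it has a point of least modulus. Below that modulus \<phi> is negative, and continuity extends the
  weak inequality to the closed disc.\<close>

lemma first_touch:
  fixes \<phi> :: "complex \<Rightarrow> real"
  assumes cont: "continuous_on \<D> \<phi>" and "\<phi> 0 < 0" and "z1 \<in> \<D>" "\<phi> z1 \<ge> 0"
  obtains z where "z \<in> \<D>" "z \<noteq> 0" "\<phi> z = 0" "\<And>x. norm x \<le> norm z \<Longrightarrow> \<phi> x \<le> 0"
proof -
  define K where "K = {x \<in> cball 0 (norm z1). \<phi> x \<in> {0..}}"
  have sub: "cball 0 (norm z1) \<subseteq> \<D>"
    using assms(3) by auto
  have "closed (cball 0 (norm z1) \<inter> \<phi> -` {0..})"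
    using continuous_on_subset[OF cont sub] by (intro continuous_closed_preimage) auto
  moreover have "cball 0 (norm z1) \<inter> \<phi> -` {0..} = K"
    by (auto simp: K_def)
  moreover have "bounded K"
    by (rule bounded_subset[OF bounded_cball[of 0 "norm z1"]]) (auto simp: K_def)
  ultimately have "compact K"
    by (simp add: compact_eq_bounded_closed)
  moreover have "K \<noteq> {}"
    using assms(4) by (auto simp: K_def)
  ultimately obtain z where z: "z \<in> K" "\<And>x. x \<in> K \<Longrightarrow> norm z \<le> norm x"
    using continuous_attains_inf[of K norm] by (auto intro: continuous_intros)
  have zD: "z \<in> \<D>" using z(1) sub by (auto simp: K_def)
  have "z \<noteq> 0" using z(1) assms(2) by (auto simp: K_def)
  have neg: "\<phi> x < 0" if "norm x < norm z" for x
    using z(1) z(2)[of x] that by (fastforce simp: K_def)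
  have le: "\<phi> x \<le> 0" if "norm x \<le> norm z" for x
  proof -
    have "\<phi> x \<le> 0" if x: "x \<in> closure (ball 0 (norm z))" for x
    proof (rule continuous_le_on_closure[OF _ x])
      show "continuous_on (closure (ball 0 (norm z))) \<phi>"
        using zD \<open>z \<noteq> 0\<close> by (intro continuous_on_subset[OF cont]) auto
      show "\<And>x. x \<in> ball 0 (norm z) \<Longrightarrow> \<phi> x \<le> 0"
        using neg by force
    qed
    then show ?thesis using that \<open>z \<noteq> 0\<close> by simp
  qed
  have "\<phi> z = 0"
    using le[of z] z(1) by (auto simp: K_def)
  with zD \<open>z \<noteq> 0\<close> le that show ?thesis by blast
qed

text \<open>Dividing by the zero at the origin gives g = w(x)/x, whose modulus over the closed disc
  is still largest at z. Then \<open>boundary_max_Re\<close> for g / g(z) shows that z w'/w - 1 is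
  real and nonnegative.\<close>

lemma jack_lemma:
  fixes w :: "complex \<Rightarrow> complex"
  assumes hol: "w holomorphic_on S" and S: "open S" "cball 0 (norm z) \<subseteq> S"
    and "w 0 = 0" and "z \<noteq> 0" and wz: "w z \<noteq> 0"
    and max: "\<And>x. norm x < norm z \<Longrightarrow> norm (w x) \<le> norm (w z)"
  obtains m where "m \<ge> 1" "z * deriv w z = of_real m * w z"
proof -
  define g where "g = (\<lambda>x. if x = 0 then deriv w 0 else (w x - w 0) / (x - 0))"
  have 0: "0 \<in> S" and zS: "z \<in> S" using S(2) by auto
  have g: "g holomorphic_on S"
    unfolding g_def by (rule pole_lemma[OF hol]) (use 0 S(1) in \<open>auto simp: interior_open\<close>)
  have bd: "norm (w x) \<le> norm (w z)" if "norm x \<le> norm z" for x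
  proof (rule continuous_le_on_closure[where S = "ball 0 (norm z)" and f = "\<lambda>x. norm (w x)"])
    show "continuous_on (closure (ball 0 (norm z))) (\<lambda>x. norm (w x))"
      using S(2) \<open>z \<noteq> 0\<close> holomorphic_on_imp_continuous_on[OF hol]
      by (intro continuous_intros) (auto intro: continuous_on_subset)
  qed (use that \<open>z \<noteq> 0\<close> max in auto)
  \<comment> \<open>On the frontier every point has modulus |z|, so there the bound for w is a bound
    for g; the maximum principle carries it inside.\<close>
  have gmax: "norm (g x) \<le> norm (g z)" if "norm x \<le> norm z" for x
  proof (rule maximum_modulus_frontier[of g "cball 0 (norm z)"])
    show "g holomorphic_on interior (cball 0 (norm z))"
      using S(2) by (intro holomorphic_on_subset[OF g]) auto
    show "continuous_on (closure (cball 0 (norm z))) g"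
      using S(2) by (intro continuous_on_subset[OF holomorphic_on_imp_continuous_on[OF g]]) auto
    show "norm (g x) \<le> norm (g z)" if "x \<in> frontier (cball 0 (norm z))" for x
      using that bd[of x] assms(4,5) by (auto simp: g_def norm_divide divide_right_mono)
  qed (use that in auto)
  have wd: "(w has_field_derivative deriv w z) (at z)"
    using hol S(1) zS by (rule holomorphic_derivI)
  have gz: "g z \<noteq> 0" using assms(4-6) by (simp add: g_def)
  have gd: "(g has_field_derivative (z * deriv w z - w z) / z\<^sup>2) (at z)"
  proof (rule has_field_derivative_transform_within_open)
    show "((\<lambda>x. w x / x) has_field_derivative (z * deriv w z - w z) / z\<^sup>2) (at z)"
      using wd \<open>z \<noteq> 0\<close> by (auto intro!: derivative_eq_intros simp: power2_eq_square mult.commute)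
    show "open (- {0::complex})" "z \<in> - {0}" using \<open>z \<noteq> 0\<close> by auto
  qed (use assms(4) in \<open>auto simp: g_def\<close>)
  have hd: "((\<lambda>x. g x / g z) has_field_derivative ((z * deriv w z - w z) / z\<^sup>2) / g z) (at z)"
    using gd by (rule DERIV_cdivide)
  have "Re (g x / g z) \<le> Re (g z / g z)" if "norm x \<le> norm z" for x
  proof -
    have "Re (g x / g z) \<le> norm (g x / g z)" by (rule complex_Re_le_cmod)
    also have "\<dots> \<le> 1" using gmax[OF that] gz by (simp add: norm_divide)
    finally show ?thesis using gz by simp
  qed
  note b = boundary_max_Re[OF hd this]
  define k where "k = z * (((z * deriv w z - w z) / z\<^sup>2) / g z)"
  have k: "k = of_real (Re k)" "Re k \<ge> 0"
    using b by (auto simp: k_def complex_eq_iff)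
  have "k = z * deriv w z / w z - 1"
    using assms(4-6) by (simp add: k_def g_def field_simps power2_eq_square)
  then have "z * deriv w z = (1 + k) * w z" using wz by (simp add: field_simps)
  also have "1 + k = of_real (1 + Re k)" by (subst k(1)) simp
  finally show ?thesis using k(2) by (intro that[of "1 + Re k"]) auto
qed

subsection \<open>Convex maps\<close>

text \<open>The analytic characterisation of convex univalent functions. Injectivity is a
  consequence, obtained in \<open>convex_map_univalent\<close>.\<close>

definition convex_map :: "(complex \<Rightarrow> complex) \<Rightarrow> bool" where
  "convex_map q \<longleftrightarrow> q holomorphic_on \<D> \<and>
     (\<forall>z\<in>\<D>. deriv q z \<noteq> 0 \<and> Re (1 + z * deriv (deriv q) z / deriv q z) > 0)"

text \<open>With p = 1 + v this reads |p - 1| < |p + 1|: the Cayley transform maps the right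
  half-plane to the unit disc.\<close>

lemma norm_less_norm_add_2_iff: "norm v < norm (2 + v) \<longleftrightarrow> Re (1 + v) > 0" for v :: complex
proof -
  have "(norm (2 + v))\<^sup>2 - (norm v)\<^sup>2 = 4 * Re (1 + v)"
    unfolding cmod_power2 by (simp add: power2_eq_square algebra_simps)
  then show ?thesis
    by (smt (verit) norm_ge_zero power2_less_imp_less power_strict_mono zero_less_numeral)
qed

text \<open>The Cayley transform z X / (2 + z X) of 1 + z X vanishes at 0 and is bounded by 1, so
  the Schwarz lemma bounds it by |z|, and |z| cancels.\<close>

lemma convex_map_norm_bound:
  assumes q: "convex_map q" and z: "z \<in> \<D>"
  defines "X \<equiv> deriv (deriv q) z / deriv q z"
  shows "norm X \<le> norm (2 + z * X)"
proof -
  define Y where "Y = (\<lambda>z. deriv (deriv q) z / deriv q z)"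
  have hol: "q holomorphic_on \<D>" and nz: "\<And>z. z \<in> \<D> \<Longrightarrow> deriv q z \<noteq> 0"
    and Re: "\<And>z. z \<in> \<D> \<Longrightarrow> Re (1 + z * Y z) > 0"
    using q by (auto simp: convex_map_def Y_def)
  have Y: "Y holomorphic_on \<D>"
    unfolding Y_def using nz by (intro holomorphic_intros hol) auto
  have lt: "norm (z * Y z) < norm (2 + z * Y z)" if "z \<in> \<D>" for z
    using Re[OF that] norm_less_norm_add_2_iff by simp
  have nz2: "2 + z * Y z \<noteq> 0" if "z \<in> \<D>" for z
    using lt[OF that] by force
  define \<phi> where "\<phi> = (\<lambda>z. z * Y z / (2 + z * Y z))"
  have \<phi>: "\<phi> holomorphic_on \<D>"
    unfolding \<phi>_def using nz2 by (intro holomorphic_intros Y) auto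
  have lt1: "norm (\<phi> z) < 1" if "norm z < 1" for z
    using lt[of z] nz2[of z] that by (auto simp: \<phi>_def norm_divide divide_simps)
  note S = Schwarz_Lemma[OF \<phi> _ lt1, simplified]
  show ?thesis
  proof (cases "z = 0")
    \<comment> \<open>No factor |z| can be cancelled here; the bound on the derivative in the
      Schwarz lemma takes its place, with derivative \<open>Y 0 / 2\<close>.\<close>
    case True
    have "(Y has_field_derivative deriv Y 0) (at 0)"
      using Y by (rule holomorphic_derivI) auto
    then have "(\<phi> has_field_derivative Y 0 / 2) (at 0)"
      unfolding \<phi>_def by (auto intro!: derivative_eq_intros)
    then show ?thesis
      using S(2)[of 0] True by (auto simp: \<phi>_def DERIV_imp_deriv norm_divide X_def Y_def)
  next
    case False
    have "norm z * norm (Y z) \<le> norm z * norm (2 + z * Y z)"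
      using S(1)[of z] z nz2[OF z] by (auto simp: \<phi>_def norm_divide norm_mult divide_simps)
    then show ?thesis using False by (simp add: X_def Y_def)
  qed
qed

section \<open>Invariance of convexity under disc automorphisms\<close>

text \<open>\<open>Moebius_function 0 (- a)\<close> is the automorphism z -> (z + a) / (1 + cnj a
  z), which sends 0 to a.\<close>

lemma moebius_derivative:
  assumes "norm a < 1" "norm z < 1"
  shows "((\<lambda>z. Moebius_function 0 (- a) z) has_field_derivative
           (1 - a * cnj a) / (1 + cnj a * z)\<^sup>2) (at z)"
    and "1 + cnj a * z \<noteq> 0"
proof -
  have "norm (cnj a * z) < 1"
    using assms mult_strict_mono[of "norm a" 1 "norm z" 1] by (simp add: norm_mult)
  then show nz: "1 + cnj a * z \<noteq> 0"
    by (metis add.commute add_eq_0_iff norm_minus_cancel norm_one order_less_irrefl)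
  then show "((\<lambda>z. Moebius_function 0 (- a) z) has_field_derivative
           (1 - a * cnj a) / (1 + cnj a * z)\<^sup>2) (at z)"
    unfolding Moebius_function_simple
    by (auto intro!: derivative_eq_intros simp: power2_eq_square field_simps)
qed

lemma deriv_comp_moebius:
  assumes N: "N holomorphic_on \<D>" and a: "a \<in> \<D>" and z: "z \<in> \<D>"
  shows "((\<lambda>z. N (Moebius_function 0 (- a) z)) has_field_derivative
     deriv N (Moebius_function 0 (- a) z) * ((1 - a * cnj a) / (1 + cnj a * z)\<^sup>2)) (at z)"
proof -
  have "Moebius_function 0 (- a) z \<in> \<D>"
    using Moebius_function_norm_lt_1[of "- a" z 0] a z by simp
  then have "(N has_field_derivative deriv N (Moebius_function 0 (- a) z)) (at (Moebius_function 0 (- a) z))"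
    using N by (auto intro: holomorphic_derivI)
  then show ?thesis
    using moebius_derivative(1)[of a z] a z by (intro DERIV_chain') auto
qed

text \<open>With \<open>X = q'' / q'\<close>, the convexity condition is equivalent to \<open>|X| \<le> |2 + z X|\<close> on the
  disc (\<open>X / (2 + z X)\<close> is the Schwarz quotient of the Cayley transform of \<open>1 + z X\<close>). A disc
  automorphism acts on this quotient again by a disc automorphism.\<close>

lemma convex_map_comp_moebius:
  assumes q: "convex_map q" and a: "a \<in> \<D>"
  shows "convex_map (\<lambda>z. q (Moebius_function 0 (- a) z))"
proof -
  have hol: "q holomorphic_on \<D>" and nz: "\<And>z. z \<in> \<D> \<Longrightarrow> deriv q z \<noteq> 0"
    using q by (auto simp: convex_map_def)
  define T where "T = Moebius_function 0 (- a)"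
  define k where "k = 1 - a * cnj a"
  define d where "d = (\<lambda>z. 1 + cnj a * z)"
  define G where "G = (\<lambda>z. q (T z))"
  have TD: "T z \<in> \<D>" if "z \<in> \<D>" for z
    using Moebius_function_norm_lt_1[of "- a" z 0] a that by (simp add: T_def)
  have dnz: "d z \<noteq> 0" if "z \<in> \<D>" for z
    using moebius_derivative(2)[of a z] a that by (simp add: d_def)
  have Tz: "T z * d z = z + a" if "z \<in> \<D>" for z
    using dnz[OF that] by (simp add: T_def d_def Moebius_function_simple)
  have knz: "k \<noteq> 0"
  proof -
    have "norm a < 1" using a by simp
    then have "(norm a)\<^sup>2 < 1" by (simp add: power_less_one_iff abs_square_less_1)
    then show ?thesis
      unfolding k_def complex_norm_square[symmetric] by (metis of_real_1 of_real_eq_iff eq_iff_diff_eq_0 less_irrefl)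
  qed
  have D1: "(G has_field_derivative deriv q (T z) * (k / (d z)\<^sup>2)) (at z)" if "z \<in> \<D>" for z
    using deriv_comp_moebius[OF hol a that] by (simp add: G_def T_def k_def d_def)
  then have Ghol: "G holomorphic_on \<D>"
    by (meson holomorphic_onI has_field_derivative_at_within field_differentiable_def)
  have dG: "deriv G z = deriv q (T z) * (k / (d z)\<^sup>2)" if "z \<in> \<D>" for z
    using D1[OF that] by (rule DERIV_imp_deriv)
  have ddG: "deriv (deriv G) z = deriv (deriv q) (T z) * (k / (d z)\<^sup>2) * (k / (d z)\<^sup>2)
       - deriv q (T z) * (2 * cnj a * k / (d z) ^ 3)" if z: "z \<in> \<D>" for z
  proof -
    have A: "((\<lambda>z. deriv q (T z)) has_field_derivative deriv (deriv q) (T z) * (k / (d z)\<^sup>2)) (at z)"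
      using deriv_comp_moebius[OF holomorphic_deriv[OF hol] a z] by (simp add: T_def k_def d_def)
    have B: "((\<lambda>z. k / (d z)\<^sup>2) has_field_derivative - (2 * cnj a * k / (d z) ^ 3)) (at z)"
    proof -
      have "(d has_field_derivative cnj a) (at z)"
        unfolding d_def by (auto intro!: derivative_eq_intros)
      then show ?thesis
        using dnz[OF z]
        by (auto intro!: derivative_eq_intros simp: field_simps power2_eq_square power3_eq_cube)
    qed
    have "((\<lambda>z. deriv q (T z) * (k / (d z)\<^sup>2)) has_field_derivative
        deriv (deriv q) (T z) * (k / (d z)\<^sup>2) * (k / (d z)\<^sup>2)
       - deriv q (T z) * (2 * cnj a * k / (d z) ^ 3)) (at z)"
      using DERIV_mult[OF A B] by (simp add: algebra_simps)
    then have "(deriv G has_field_derivative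
        deriv (deriv q) (T z) * (k / (d z)\<^sup>2) * (k / (d z)\<^sup>2)
       - deriv q (T z) * (2 * cnj a * k / (d z) ^ 3)) (at z)"
      by (rule has_field_derivative_transform_within_open[OF _ open_ball z]) (simp add: dG)
    then show ?thesis by (rule DERIV_imp_deriv)
  qed
  have "Re (1 + z * deriv (deriv G) z / deriv G z) > 0" if z: "z \<in> \<D>" for z
  proof -
    define X where "X = deriv (deriv q) (T z) / deriv q (T z)"
    define s where "s = 2 + T z * X"
    define Y where "Y = deriv (deriv G) z / deriv G z"
    have Xs: "norm X \<le> norm s"
      using convex_map_norm_bound[OF q TD[OF z]] by (simp add: X_def s_def)
    have "Y = X * k / (d z)\<^sup>2 - 2 * cnj a / d z"
      using dnz[OF z] nz[OF TD[OF z]] knz unfolding Y_def X_def dG[OF z] ddG[OF z]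
      by (simp add: field_simps power2_eq_square power3_eq_cube)
    then have Y: "Y = (X * k - 2 * cnj a * d z) / (d z)\<^sup>2"
      using dnz[OF z] by (simp add: field_simps power2_eq_square)
    have "X * k - 2 * cnj a * d z = (X * d z - cnj a * (2 * d z + (T z * d z) * X))"
      unfolding Tz[OF z] by (simp add: k_def d_def algebra_simps)
    also have "\<dots> = (X - cnj a * s) * d z" by (simp add: s_def algebra_simps)
    finally have Y1: "Y = (X - cnj a * s) / d z"
      using dnz[OF z] by (simp add: Y power2_eq_square)
    \<comment> \<open>Together with \<open>Y1\<close> this leads to Y / (2 + z Y) = (X - cnj a s) /
      (s - a X), a disc automorphism applied to X / s.\<close>
    have "(2 + z * Y) * d z = 2 * d z + z * (X - cnj a * s)"
    proof -
      have "Y * d z = X - cnj a * s" using dnz[OF z] by (simp add: Y1)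
      then have "2 * d z + z * (X - cnj a * s) = 2 * d z + z * (Y * d z)" by simp
      then show ?thesis by (simp add: algebra_simps)
    qed
    also have "\<dots> = 2 * (d z - z * cnj a) + (z - z * cnj a * T z) * X"
      by (simp add: s_def algebra_simps)
    also have "z - z * cnj a * T z = z - (d z - 1) * T z" by (simp add: d_def algebra_simps)
    also have "\<dots> = T z - a" using Tz[OF z] by (simp add: algebra_simps)
    also have "2 * (d z - z * cnj a) + (T z - a) * X = s - a * X"
      by (simp add: s_def d_def algebra_simps)
    finally have Y2: "2 + z * Y = (s - a * X) / d z"
      using dnz[OF z] by (simp add: field_simps)
    \<comment> \<open>The identity behind the fact that disc automorphisms preserve the unit disc,
      in homogeneous form.\<close>
    have "(norm (s - a * X))\<^sup>2 - (norm (X - cnj a * s))\<^sup>2 = ((norm s)\<^sup>2 - (norm X)\<^sup>2) * (1 - (norm a)\<^sup>2)"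
      unfolding cmod_power2 by (simp add: power2_eq_square algebra_simps)
    moreover have "((norm s)\<^sup>2 - (norm X)\<^sup>2) * (1 - (norm a)\<^sup>2) \<ge> 0"
      using Xs a by (intro mult_nonneg_nonneg) (auto simp: power_mono power_le_one)
    ultimately have "(norm (X - cnj a * s))\<^sup>2 \<le> (norm (s - a * X))\<^sup>2" by linarith
    then have "norm (X - cnj a * s) \<le> norm (s - a * X)" by (rule power2_le_imp_le) simp
    then have le: "norm Y \<le> norm (2 + z * Y)"
      unfolding Y2 unfolding Y1 norm_divide by (rule divide_right_mono) simp
    \<comment> \<open>Strictness comes from |z Y| < |Y|, since |z| < 1; only Y = 0 has to be
      separated.\<close>
    have "Re (1 + z * Y) > 0"
    proof (cases "Y = 0")
      case False
      then have "norm (z * Y) < norm Y" using z by (simp add: norm_mult)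
      with le have "norm (z * Y) < norm (2 + z * Y)" by linarith
      then show ?thesis unfolding norm_less_norm_add_2_iff .
    qed auto
    then show ?thesis by (simp add: Y_def)
  qed
  moreover have "deriv G z \<noteq> 0" if "z \<in> \<D>" for z
    using dG[OF that] nz[OF TD[OF that]] dnz[OF that] knz by simp
  ultimately show ?thesis
    using Ghol unfolding convex_map_def G_def T_def by blast
qed

section \<open>Starlikeness and close-to-convexity\<close>

text \<open>Convex maps are starlike. With Q = 1 + z q''/q', the quotient y = (q - q(0)) / (z q')
  satisfies z y' + y Q = 1 and y(0) = 1, and this equation excludes a first zero of Re y.\<close>

lemma convex_map_starlike_0:
  assumes q: "convex_map q" and z: "z \<in> \<D>" "z \<noteq> 0"
  shows "Re ((q z - q 0) / (z * deriv q z)) > 0"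
proof -
  have hol: "q holomorphic_on \<D>" and nz: "\<And>z. z \<in> \<D> \<Longrightarrow> deriv q z \<noteq> 0"
    and Re: "\<And>z. z \<in> \<D> \<Longrightarrow> Re (1 + z * deriv (deriv q) z / deriv q z) > 0"
    using q by (auto simp: convex_map_def)
  define g where "g = (\<lambda>z. if z = 0 then deriv q 0 else (q z - q 0) / (z - 0))"
  have g: "g holomorphic_on \<D>"
    unfolding g_def by (rule pole_lemma[OF hol]) auto
  have qg: "q z = q 0 + z * g z" for z by (simp add: g_def)
  \<comment> \<open>the reciprocal of \<open>z q' / (q - q 0)\<close>, which is holomorphic before \<open>q \<noteq> q 0\<close> is known\<close>
  define y where "y = (\<lambda>z. g z / deriv q z)"
  have y: "y holomorphic_on \<D>"
    unfolding y_def using nz by (intro holomorphic_intros g hol) auto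
  have ode: "z * deriv y z + y z * (1 + z * deriv (deriv q) z / deriv q z) = 1" if z: "z \<in> \<D>" for z
  proof -
    have g': "(g has_field_derivative deriv g z) (at z)"
      using g z by (intro holomorphic_derivI) auto
    have "((\<lambda>z. q 0 + z * g z) has_field_derivative g z + z * deriv g z) (at z)"
      by (auto intro!: derivative_eq_intros g')
    then have dq: "deriv q z = g z + z * deriv g z"
      by (subst (asm) qg[symmetric]) (rule DERIV_imp_deriv)
    have "(deriv q has_field_derivative deriv (deriv q) z) (at z)"
      using holomorphic_deriv[OF hol] z by (intro holomorphic_derivI) auto
    then have "(y has_field_derivative (deriv g z * deriv q z - g z * deriv (deriv q) z) / (deriv q z)\<^sup>2) (at z)"
      unfolding y_def using nz[OF z] by (auto intro!: derivative_eq_intros g' simp: power2_eq_square)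
    then have "deriv y z = (deriv g z * deriv q z - g z * deriv (deriv q) z) / (deriv q z)\<^sup>2"
      by (rule DERIV_imp_deriv)
    then have "z * deriv y z = ((z * deriv g z) * deriv q z - g z * (z * deriv (deriv q) z)) / (deriv q z)\<^sup>2"
      by (simp add: algebra_simps)
    also have "z * deriv g z = deriv q z - g z" using dq by simp
    finally show ?thesis
      using nz[OF z] by (simp add: y_def field_simps power2_eq_square)
  qed
  have "Re (y z) > 0"
  proof (rule ccontr)
    assume neg: "\<not> Re (y z) > 0"
    obtain w where w: "w \<in> \<D>" "w \<noteq> 0" "- Re (y w) = 0"
      and le: "\<And>x. norm x \<le> norm w \<Longrightarrow> - Re (y x) \<le> 0"
    proof (rule first_touch[of "\<lambda>x. - Re (y x)" z])
      show "continuous_on \<D> (\<lambda>x. - Re (y x))"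
        by (intro continuous_intros holomorphic_on_imp_continuous_on y)
    qed (use z neg nz[of 0] in \<open>auto simp: y_def g_def\<close>)
    have "((\<lambda>x. - y x) has_field_derivative - deriv y w) (at w)"
      using y w by (intro derivative_intros holomorphic_derivI[of y \<D>]) auto
    from boundary_max_Re[OF this] le w
    have sg: "Im (w * deriv y w) = 0" "Re (w * deriv y w) \<le> 0"
      by auto
    define Q where "Q = 1 + w * deriv (deriv q) w / deriv q w"
    have Q: "w * deriv y w + y w * Q = 1" "Re Q > 0"
      using ode[OF w(1)] Re[OF w(1)] by (auto simp: Q_def)
    \<comment> \<open>Here y is purely imaginary and y Q = 1 - w y' is real. As Re Q > 0, this
      forces y = 0, so w y' = 1, against the sign of w y'.\<close>
    have "Im (y w * Q) = 0"
      using Q(1) sg(1) by (metis add_0 imaginary_unit.sel(1) one_complex.sel(2) plus_complex.sel(2))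
    then have "Im (y w) = 0" using w(3) Q(2) by simp
    then have "y w = 0" using w(3) by (simp add: complex_eq_iff)
    then show False using Q(1) sg(2) by simp
  qed
  then show ?thesis using z by (simp add: y_def g_def divide_simps mult.commute)
qed

text \<open>The ratio p = (N - N(0)) / (q - q(0)) keeps positive real part, hence does not vanish.
  Indeed N'/q' = p + (z p') ((q - q(0)) / (z q')); at a first zero of Re p the factor z p' is real
  and nonpositive, and starlikeness of q then makes Re (N'/q') nonpositive.\<close>

lemma close_to_convex_0:
  assumes q: "convex_map q" and N: "N holomorphic_on \<D>"
    and pos: "\<And>z. z \<in> \<D> \<Longrightarrow> Re (deriv N z / deriv q z) > 0"
    and z: "z \<in> \<D>" "z \<noteq> 0"
  shows "N z \<noteq> N 0"
proof -
  have hol: "q holomorphic_on \<D>" and nz: "\<And>z. z \<in> \<D> \<Longrightarrow> deriv q z \<noteq> 0"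
    using q by (auto simp: convex_map_def)
  define g where "g = (\<lambda>z. if z = 0 then deriv q 0 else (q z - q 0) / (z - 0))"
  define n where "n = (\<lambda>z. if z = 0 then deriv N 0 else (N z - N 0) / (z - 0))"
  have g: "g holomorphic_on \<D>"
    unfolding g_def by (rule pole_lemma[OF hol]) auto
  have n: "n holomorphic_on \<D>"
    unfolding n_def by (rule pole_lemma[OF N]) auto
  have gnz: "g z \<noteq> 0" if "z \<in> \<D>" for z
    using nz[OF that] convex_map_starlike_0[OF q that] by (auto simp: g_def)
  define p where "p = (\<lambda>z. n z / g z)"
  have p: "p holomorphic_on \<D>"
    unfolding p_def using gnz by (intro holomorphic_intros g n) auto
  have Np: "N z = N 0 + p z * (q z - q 0)" if "z \<in> \<D>" for z
    using gnz[OF that] by (auto simp: p_def n_def g_def field_simps)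
  have "Re (p z) > 0"
  proof (rule ccontr)
    assume neg: "\<not> Re (p z) > 0"
    obtain w where w: "w \<in> \<D>" "w \<noteq> 0" "- Re (p w) = 0"
      and le: "\<And>x. norm x \<le> norm w \<Longrightarrow> - Re (p x) \<le> 0"
    proof (rule first_touch[of "\<lambda>x. - Re (p x)" z])
      show "continuous_on \<D> (\<lambda>x. - Re (p x))"
        by (intro continuous_intros holomorphic_on_imp_continuous_on p)
    qed (use z neg pos[of 0] in \<open>auto simp: p_def g_def n_def\<close>)
    have p': "(p has_field_derivative deriv p w) (at w)"
      using p w by (intro holomorphic_derivI) auto
    have "((\<lambda>x. - p x) has_field_derivative - deriv p w) (at w)"
      using p' by (rule DERIV_minus)
    from boundary_max_Re[OF this] le w
    have sg: "Im (w * deriv p w) = 0" "Re (w * deriv p w) \<le> 0"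
      by auto
    have q': "(q has_field_derivative deriv q w) (at w)"
      using hol w by (intro holomorphic_derivI) auto
    have "((\<lambda>z. N 0 + p z * (q z - q 0)) has_field_derivative
        p w * deriv q w + deriv p w * (q w - q 0)) (at w)"
      by (auto intro!: derivative_eq_intros p' q')
    then have "(N has_field_derivative p w * deriv q w + deriv p w * (q w - q 0)) (at w)"
      by (rule has_field_derivative_transform_within_open[OF _ open_ball w(1)]) (rule Np[symmetric])
    then have "deriv N w / deriv q w = p w + (w * deriv p w) * ((q w - q 0) / (w * deriv q w))"
      using nz[OF w(1)] w(2) by (subst DERIV_imp_deriv) (auto simp: field_simps)
    then have "Re (deriv N w / deriv q w) = Re (w * deriv p w) * Re ((q w - q 0) / (w * deriv q w))"
    proof -
      have Re_mult: "Re (A * B) = Re A * Re B" if "Im A = 0" for A B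
        using that by simp
      show ?thesis
        unfolding \<open>deriv N w / deriv q w = _\<close> plus_complex.sel Re_mult[OF sg(1)] using w(3) by simp
    qed
    also have "\<dots> \<le> 0"
      using sg(2) convex_map_starlike_0[OF q w(1,2)] by (intro mult_nonpos_nonneg) auto
    finally show False using pos[OF w(1)] by simp
  qed
  then have "n z \<noteq> 0" by (auto simp: p_def)
  then show ?thesis using z by (auto simp: n_def)
qed

text \<open>A disc automorphism moves one of two points with equal values to the origin. It
  multiplies N' and q' by the same factor, so the hypothesis on N'/q' survives and
  \<open>close_to_convex_0\<close> applies.\<close>

lemma close_to_convex_inj:
  assumes q: "convex_map q" and N: "N holomorphic_on \<D>"
    and pos: "\<And>z. z \<in> \<D> \<Longrightarrow> Re (deriv N z / deriv q z) > 0"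
  shows "inj_on N \<D>"
proof (rule inj_onI, rule ccontr)
  fix a b assume ab: "a \<in> \<D>" "b \<in> \<D>" "N a = N b" "a \<noteq> b"
  have hol: "q holomorphic_on \<D>" using q by (auto simp: convex_map_def)
  define T where "T = Moebius_function 0 (- a)"
  define z where "z = Moebius_function 0 a b"
  have z: "z \<in> \<D>" 
    using Moebius_function_norm_lt_1[of a b 0] ab by (simp add: z_def)
  have Tz: "T z = b"
    using Moebius_function_compose[of "- a" "a" b] ab by (simp add: z_def T_def)
  have T0: "T 0 = a" by (simp add: T_def Moebius_function_simple)
  have "z \<noteq> 0" using Tz T0 ab by auto
  have TD: "T x \<in> \<D>" if "x \<in> \<D>" for x
    using Moebius_function_norm_lt_1[of "- a" x 0] ab that by (simp add: T_def)
  have "N (T z) \<noteq> N (T 0)"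
  proof (rule close_to_convex_0[of "\<lambda>z. q (T z)" "\<lambda>z. N (T z)"])
    show "convex_map (\<lambda>z. q (T z))"
      unfolding T_def by (rule convex_map_comp_moebius[OF q ab(1)])
    then have nz: "deriv (\<lambda>z. q (T z)) x \<noteq> 0" if "x \<in> \<D>" for x
      using that by (auto simp: convex_map_def)
    note dN = deriv_comp_moebius[OF N ab(1), folded T_def]
    note dq = deriv_comp_moebius[OF hol ab(1), folded T_def]
    show "(\<lambda>z. N (T z)) holomorphic_on \<D>"
      using dN by (meson holomorphic_onI has_field_derivative_at_within field_differentiable_def)
    show "Re (deriv (\<lambda>z. N (T z)) x / deriv (\<lambda>z. q (T z)) x) > 0" if x: "x \<in> \<D>" for x
      using nz[OF x] pos[OF TD[OF x]] unfolding DERIV_imp_deriv[OF dN[OF x]] DERIV_imp_deriv[OF dq[OF x]]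
      by simp
  qed (use z \<open>z \<noteq> 0\<close> in auto)
  then show False using Tz T0 ab(3) by simp
qed

subsection \<open>The subordination chain\<close>

text \<open>The time t = 0 gives q itself and t = 1/\<beta> gives the differential expression of the
  theorem, so one family covers both.\<close>

definition radial_chain :: "(complex \<Rightarrow> complex) \<Rightarrow> real \<Rightarrow> complex \<Rightarrow> complex" where
  "radial_chain q t z = q z + of_real t * (z * deriv q z)"

lemma radial_chain_derivative:
  assumes q: "convex_map q" and z: "z \<in> \<D>"
  shows "(radial_chain q t has_field_derivative
           deriv q z * (1 + of_real t * (1 + z * deriv (deriv q) z / deriv q z))) (at z)"
proof -
  have hol: "q holomorphic_on \<D>" and nz: "deriv q z \<noteq> 0"
    using q z by (auto simp: convex_map_def)
  have q': "(q has_field_derivative deriv q z) (at z)"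
    using hol z by (intro holomorphic_derivI) auto
  have q'': "(deriv q has_field_derivative deriv (deriv q) z) (at z)"
    using holomorphic_deriv[OF hol] z by (intro holomorphic_derivI) auto
  show ?thesis
    unfolding radial_chain_def using nz
    by (auto intro!: derivative_eq_intros q' q'' simp: field_simps)
qed

lemma radial_chain_holomorphic:
  assumes "convex_map q" shows "radial_chain q t holomorphic_on \<D>"
  using radial_chain_derivative[OF assms]
  by (meson holomorphic_onI has_field_derivative_at_within field_differentiable_def)

text \<open>The chain is close-to-convex with respect to q: its derivative divided by q' is 1 + t (1
  + z q''/q'), of positive real part.\<close>

lemma radial_chain_inj:
  assumes q: "convex_map q" and t: "t \<ge> 0"
  shows "inj_on (radial_chain q t) \<D>"
proof (rule close_to_convex_inj[OF q radial_chain_holomorphic[OF q]])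
  fix z assume z: "z \<in> \<D>"
  have nz: "deriv q z \<noteq> 0" and Re: "Re (1 + z * deriv (deriv q) z / deriv q z) > 0"
    using q z by (auto simp: convex_map_def)
  have "t * Re (1 + z * deriv (deriv q) z / deriv q z) \<ge> 0"
    using t Re by (intro mult_nonneg_nonneg) auto
  then show "Re (deriv (radial_chain q t) z / deriv q z) > 0"
    unfolding DERIV_imp_deriv[OF radial_chain_derivative[OF q z]] using nz
    by (simp del: times_complex.sel add: Re_complex_of_real times_complex.sel(1)[of "of_real t"])
qed

text \<open>The value W is followed in time. By compactness there is a last time \<tau> in [s,t] at
  which W is taken in the closed disc of radius |z|; if \<tau> < t, the solution continues to later
  times while moving inwards, a contradiction.\<close>

lemma radial_chain_subordinate:
  assumes q: "convex_map q" and s: "0 \<le> s" "s \<le> t" and z: "z \<in> \<D>"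
  obtains z' where "norm z' \<le> norm z" "radial_chain q t z' = radial_chain q s z"
proof -
  have hol: "q holomorphic_on \<D>" and nz: "\<And>z. z \<in> \<D> \<Longrightarrow> deriv q z \<noteq> 0"
    and Re: "\<And>z. z \<in> \<D> \<Longrightarrow> Re (1 + z * deriv (deriv q) z / deriv q z) > 0"
    using q by (auto simp: convex_map_def)
  have hol': "deriv q holomorphic_on \<D>" using hol by (rule holomorphic_deriv) auto
  define W where "W = radial_chain q s z"
  define C where "C = cball (0::complex) (norm z) \<times> {s..t}"
  define A where "A = C \<inter> (\<lambda>x. radial_chain q (snd x) (fst x)) -` {W}"
  have sub: "cball 0 (norm z) \<subseteq> \<D>" using z by auto
  have "continuous_on C (\<lambda>x. radial_chain q (snd x) (fst x))"
    unfolding radial_chain_def C_def using sub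
    by (intro continuous_intros continuous_on_compose2[OF holomorphic_on_imp_continuous_on[OF hol]]
          continuous_on_compose2[OF holomorphic_on_imp_continuous_on[OF hol']]) auto
  then have "closed A"
    unfolding A_def by (intro continuous_closed_preimage) (auto simp: C_def intro: closed_Times)
  moreover have "bounded A"
    by (rule bounded_subset[of C]) (auto simp: A_def C_def intro: bounded_Times)
  ultimately have "compact A"
    by (simp add: compact_eq_bounded_closed)
  moreover have "(z, s) \<in> A"
    using s by (simp add: A_def C_def W_def)
  then have "A \<noteq> {}" by blast
  ultimately obtain x where x: "x \<in> A" "\<And>y. y \<in> A \<Longrightarrow> snd y \<le> snd x"
    using continuous_attains_sup[of A snd] continuous_on_snd[OF continuous_on_id] by blast
  obtain \<zeta> \<tau> where x_def: "x = (\<zeta>, \<tau>)" by (cases x)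
  have \<zeta>: "norm \<zeta> \<le> norm z" "s \<le> \<tau>" "\<tau> \<le> t" "radial_chain q \<tau> \<zeta> = W"
    using x(1) by (auto simp: A_def C_def x_def)
  have max: "\<tau>' \<le> \<tau>" if "norm \<zeta>' \<le> norm z" "s \<le> \<tau>'" "\<tau>' \<le> t" "radial_chain q \<tau>' \<zeta>' = W" for \<zeta>' \<tau>'
    using x(2)[of "(\<zeta>', \<tau>')"] that by (auto simp: A_def C_def x_def)
  have "\<tau> = t"
  proof (rule ccontr)
    assume "\<tau> \<noteq> t"
    then have "\<tau> < t" using \<zeta> by simp
    \<comment> \<open>At the origin the chain has the value q(0) at all times, so W would still be
      attained there at time t.\<close>
    have "\<zeta> \<noteq> 0"
      using max[of 0 t] \<zeta> s \<open>\<tau> < t\<close> by (auto simp: radial_chain_def)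
    define U where "U = \<D> - {0}"
    have U: "open U" "\<zeta> \<in> U" using \<open>\<zeta> \<noteq> 0\<close> \<zeta>(1) z by (auto simp: U_def)
    \<comment> \<open>\<open>S x = \<tau>\<close> says that the chain has value \<open>W\<close> at \<open>x\<close> and time \<open>\<tau>\<close>; as \<open>Re (\<zeta> S') < 0\<close>,
      increasing the time moves the solution towards the origin\<close>
    define S where "S = (\<lambda>x. (W - q x) / (x * deriv q x))"
    have S: "S holomorphic_on U"
      unfolding S_def U_def using nz by (intro holomorphic_intros holomorphic_on_subset[OF hol] holomorphic_on_subset[OF hol']) auto
    define Q where "Q = 1 + \<zeta> * deriv (deriv q) \<zeta> / deriv q \<zeta>"
    have \<zeta>D: "\<zeta> \<in> \<D>" using U by (auto simp: U_def)
    have WS: "W = radial_chain q a x \<longleftrightarrow> S x = of_real a" if "x \<in> U" for x a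
      using nz[of x] that by (auto simp: radial_chain_def S_def U_def field_simps)
    have S\<zeta>: "S \<zeta> = of_real \<tau>" using WS[OF U(2), of \<tau>] \<zeta>(4) by simp
    have q': "(q has_field_derivative deriv q \<zeta>) (at \<zeta>)"
      using hol \<zeta>D by (intro holomorphic_derivI) auto
    have q'': "(deriv q has_field_derivative deriv (deriv q) \<zeta>) (at \<zeta>)"
      using hol' \<zeta>D by (intro holomorphic_derivI) auto
    have Wq: "W = q \<zeta> + of_real \<tau> * (\<zeta> * deriv q \<zeta>)"
      using \<zeta>(4) by (simp add: radial_chain_def)
    have "(S has_field_derivative
        ((0 - deriv q \<zeta>) * (\<zeta> * deriv q \<zeta>) - (W - q \<zeta>) * (deriv q \<zeta> + \<zeta> * deriv (deriv q) \<zeta>))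
          / ((\<zeta> * deriv q \<zeta>) * (\<zeta> * deriv q \<zeta>))) (at \<zeta>)"
      unfolding S_def using nz[OF \<zeta>D] \<open>\<zeta> \<noteq> 0\<close>
      by (auto intro!: derivative_eq_intros q' q'')
    also have "((0 - deriv q \<zeta>) * (\<zeta> * deriv q \<zeta>) - (W - q \<zeta>) * (deriv q \<zeta> + \<zeta> * deriv (deriv q) \<zeta>))
          / ((\<zeta> * deriv q \<zeta>) * (\<zeta> * deriv q \<zeta>)) = - (1 + of_real \<tau> * Q) / \<zeta>"
      using nz[OF \<zeta>D] \<open>\<zeta> \<noteq> 0\<close> by (simp add: Wq Q_def field_simps)
    finally have S': "(S has_field_derivative - (1 + of_real \<tau> * Q) / \<zeta>) (at \<zeta>)" .
    have ReQ: "Re (1 + of_real \<tau> * Q) > 0"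
    proof -
      have "\<tau> * Re Q \<ge> 0"
        using Re[OF \<zeta>D] \<zeta>(2) s(1) unfolding Q_def by (intro mult_nonneg_nonneg) auto
      then show ?thesis by simp
    qed
    then have Qnz: "1 + of_real \<tau> * Q \<noteq> 0" by force
    then have "deriv S \<zeta> \<noteq> 0"
      unfolding DERIV_imp_deriv[OF S'] using \<open>\<zeta> \<noteq> 0\<close> by (metis divide_eq_0_iff neg_equal_0_iff_equal)
    \<comment> \<open>The local inverse g of S gives the position of the solution as a holomorphic
      function of the time.\<close>
    then obtain r where r: "r > 0" "ball \<zeta> r \<subseteq> U" "open (S ` ball \<zeta> r)" "inj_on S (ball \<zeta> r)"
      using has_complex_derivative_locally_invertible[OF S U(2,1)] by blast
    obtain g where g: "g holomorphic_on S ` ball \<zeta> r"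
      "\<And>x. x \<in> ball \<zeta> r \<Longrightarrow> deriv S x * deriv g (S x) = 1" "\<And>x. x \<in> ball \<zeta> r \<Longrightarrow> g (S x) = x"
      using holomorphic_has_inverse[OF holomorphic_on_subset[OF S r(2)] open_ball r(4)] by blast
    have "deriv g (of_real \<tau>) = - \<zeta> / (1 + of_real \<tau> * Q)"
    proof -
      have solve: "D = - \<zeta> / k" if "- k / \<zeta> * D = 1" "k \<noteq> 0" for k D
        using that \<open>\<zeta> \<noteq> 0\<close> by (simp add: field_simps) (metis add.inverse_inverse)
      show ?thesis
        by (rule solve[OF _ Qnz]) (use g(2)[of \<zeta>] r(1) in \<open>simp only: centre_in_ball DERIV_imp_deriv[OF S'] S\<zeta>\<close>)
    qed
    moreover have "of_real \<tau> \<in> S ` ball \<zeta> r"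
      using S\<zeta> r(1) by (metis centre_in_ball imageI)
    ultimately have "(g has_field_derivative - \<zeta> / (1 + of_real \<tau> * Q)) (at (of_real \<tau>))"
      using g(1) r(3) by (metis holomorphic_derivI)
    then have "((\<lambda>x. g x / \<zeta>) has_field_derivative (- \<zeta> / (1 + of_real \<tau> * Q)) / \<zeta>) (at (of_real \<tau>))"
      by (rule DERIV_cdivide)
    then have "((\<lambda>a. g (of_real a) / \<zeta>) has_vector_derivative (- \<zeta> / (1 + of_real \<tau> * Q)) / \<zeta>) (at \<tau>)"
      by (rule has_vector_derivative_real_field)
    then have gv: "((\<lambda>a. g (of_real a) / \<zeta>) has_vector_derivative - (1 / (1 + of_real \<tau> * Q))) (at \<tau>)"
      using \<open>\<zeta> \<noteq> 0\<close> by simp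
    have g\<tau>: "g (of_real \<tau>) = \<zeta>" using g(3)[of \<zeta>] S\<zeta> r(1) by simp
    \<comment> \<open>Normalised to f(\<tau>) = 1, so that the derivative of |f|^2 at \<tau> is 2 Re
      f'(\<tau>), which is negative.\<close>
    define f where "f = (\<lambda>a::real. g (of_real a) / \<zeta>)"
    have f\<tau>: "f \<tau> = 1" using g\<tau> \<open>\<zeta> \<noteq> 0\<close> by (simp add: f_def)
    note f' = gv[folded f_def]
    have "((\<lambda>a. (Re (f a))\<^sup>2 + (Im (f a))\<^sup>2) has_real_derivative
        2 * Re (- (1 / (1 + of_real \<tau> * Q)))) (at \<tau>)"
      by (rule DERIV_cong[OF DERIV_add[OF DERIV_power[OF has_field_derivative_Re[OF f'], of 2]
              DERIV_power[OF has_field_derivative_Im[OF f'], of 2]]]) (simp add: f\<tau>)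
    then have "((\<lambda>a. (norm (f a))\<^sup>2) has_real_derivative
        2 * Re (- (1 / (1 + of_real \<tau> * Q)))) (at \<tau>)"
      unfolding cmod_power2 .
    moreover have "2 * Re (- (1 / k)) < 0" if "Re k > 0" for k
    proof -
      have "(Re k)\<^sup>2 + (Im k)\<^sup>2 > 0" using that by (simp add: sum_power2_gt_zero_iff)
      then show ?thesis using that by (simp add: Re_divide)
    qed
    note this[OF ReQ]
    ultimately obtain d where d: "d > 0"
      "\<And>h. h > 0 \<Longrightarrow> h < d \<Longrightarrow> (norm (f (\<tau> + h)))\<^sup>2 < (norm (f \<tau>))\<^sup>2"
      using DERIV_neg_dec_right by blast
    obtain e where e: "e > 0" "ball (of_real \<tau>) e \<subseteq> S ` ball \<zeta> r"
      using r(3) \<open>of_real \<tau> \<in> S ` ball \<zeta> r\<close> by (meson open_contains_ball)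
    \<comment> \<open>Below d the modulus decreases, below e the time \<tau> + h lies in the range
      of S near \<zeta>, and t - \<tau> keeps it in [s,t].\<close>
    define h where "h = min (min (d / 2) (e / 2)) (t - \<tau>)"
    have h: "h > 0" "h < d" "h < e" "\<tau> + h \<le> t"
      using d(1) e(1) \<open>\<tau> < t\<close> by (auto simp: h_def)
    have "(of_real (\<tau> + h) :: complex) \<in> ball (of_real \<tau>) e"
      using h by (simp add: dist_norm)
    then obtain y where y: "y \<in> ball \<zeta> r" "S y = of_real (\<tau> + h)"
      using e(2) by (metis imageE subsetD)
    have "(norm (y / \<zeta>))\<^sup>2 < 1"
      using d(2)[OF h(1,2)] g(3)[OF y(1)] y(2) f\<tau> by (simp add: f_def)
    then have "norm y < norm \<zeta>"
      using \<open>\<zeta> \<noteq> 0\<close> by (simp add: norm_divide abs_square_less_1)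
    moreover have "radial_chain q (\<tau> + h) y = W"
      using WS[of y "\<tau> + h"] y r(2) by auto
    ultimately show False
      using max[of y "\<tau> + h"] h \<zeta> by auto
  qed
  then show ?thesis using \<zeta> that by (simp add: W_def)
qed

section \<open>Subordination by excluding a first contact\<close>

text \<open>The images of the discs |x| < \<rho> with \<rho> < 1 serve as targets, so G is used only
  inside the unit disc. If F leaves such an image before |z| = \<rho>, then at an exit point of
  least modulus the function w, the inverse of G after F, satisfies Jack's lemma with |w| = \<rho>,
  and the chain rule turns its conclusion into a forbidden contact.\<close>

lemma subordinate_criterion:
  fixes F G :: "complex \<Rightarrow> complex"
  assumes F: "F holomorphic_on \<D>" and G: "univalent G" and eq0: "F 0 = G 0"
    and no_contact: "\<And>z \<zeta> m. \<lbrakk>norm z < norm \<zeta>; norm \<zeta> < 1; F z = G \<zeta>; m \<ge> 1;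
        z * deriv F z = of_real m * (\<zeta> * deriv G \<zeta>)\<rbrakk> \<Longrightarrow> False"
  shows "F \<prec> G"
proof -
  have hG: "G holomorphic_on \<D>" and injG: "inj_on G \<D>"
    using G by (auto simp: univalent_def)
  obtain g where g: "g holomorphic_on G ` \<D>"
      "\<And>x. x \<in> \<D> \<Longrightarrow> deriv G x * deriv g (G x) = 1" "\<And>x. x \<in> \<D> \<Longrightarrow> g (G x) = x"
    using holomorphic_has_inverse[OF hG open_ball injG] by blast
  have openG: "open (G ` ball 0 r)" if "r \<le> 1" for r
    using open_mapping_thm3[of G "ball 0 r"] that holomorphic_on_subset[OF hG] inj_on_subset[OF injG]
    by (meson ball_subset_ball_iff open_ball subset_ball)
  have in_image: "F z \<in> G ` ball 0 \<rho>" if \<rho>: "\<rho> < 1" and z: "norm z < \<rho>" for z \<rho>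
  proof (rule ccontr)
    assume contra: "F z \<notin> G ` ball 0 \<rho>"
    define K where "K = cball 0 (norm z) \<inter> F -` (- (G ` ball 0 \<rho>))"
    have sub: "cball 0 (norm z) \<subseteq> \<D>" using \<rho> z by auto
    have "closed K"
      unfolding K_def using openG[of \<rho>] \<rho>
      by (intro continuous_closed_preimage continuous_on_subset[OF holomorphic_on_imp_continuous_on[OF F] sub]) auto
    moreover have "bounded K"
      by (rule bounded_subset[OF bounded_cball[of 0 "norm z"]]) (auto simp: K_def)
    ultimately have "compact K" by (simp add: compact_eq_bounded_closed)
    moreover have "K \<noteq> {}" using contra by (auto simp: K_def)
    ultimately obtain a where a: "a \<in> K" "\<And>x. x \<in> K \<Longrightarrow> norm a \<le> norm x"
      using continuous_attains_inf[of K norm] by (auto intro: continuous_intros)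
    have az: "norm a \<le> norm z" and Fa: "F a \<notin> G ` ball 0 \<rho>" using a(1) by (auto simp: K_def)
    have "\<rho> > 0" using z norm_ge_zero[of z] by linarith
    then have "a \<noteq> 0" using Fa eq0 by auto
    have inside: "F x \<in> G ` ball 0 \<rho>" if "norm x < norm a" for x
      using a(2)[of x] that az by (fastforce simp: K_def)
    have comp: "compact (G ` cball 0 \<rho>)"
      using \<rho> by (intro compact_continuous_image continuous_on_subset[OF holomorphic_on_imp_continuous_on[OF hG]]) auto
    have "F ` closure (ball 0 (norm a)) \<subseteq> G ` cball 0 \<rho>"
    proof (rule image_closure_subset)
      show "continuous_on (closure (ball 0 (norm a))) F"
        using \<open>a \<noteq> 0\<close> az \<rho> z by (intro continuous_on_subset[OF holomorphic_on_imp_continuous_on[OF F]]) auto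
      show "closed (G ` cball 0 \<rho>)" using comp by (rule compact_imp_closed)
      show "F ` ball 0 (norm a) \<subseteq> G ` cball 0 \<rho>" using inside by fastforce
    qed
    then have F_cball: "F x \<in> G ` cball 0 \<rho>" if "norm x \<le> norm a" for x
      using that \<open>a \<noteq> 0\<close> by (auto simp: image_subset_iff)
    then obtain \<zeta> where \<zeta>: "norm \<zeta> \<le> \<rho>" "F a = G \<zeta>" by fastforce
    then have n\<zeta>: "norm \<zeta> = \<rho>" using Fa by (force simp: image_iff)
    \<comment> \<open>The inverse of G can be composed with F only where F takes values of G; this
      open set contains the closed disc required by Jack's lemma.\<close>
    define S where "S = \<D> \<inter> F -` (G ` \<D>)"
    have S: "open S"
      unfolding S_def using openG[of 1] holomorphic_on_imp_continuous_on[OF F]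
      by (intro continuous_open_preimage) auto
    have aS: "cball 0 (norm a) \<subseteq> S"
      using F_cball az \<rho> z by (fastforce simp: S_def)
    define w where "w = (\<lambda>x. g (F x))"
    have w: "w holomorphic_on S"
      unfolding w_def by (rule holomorphic_on_compose_gen[of F _ g "G ` \<D>", unfolded o_def])
        (auto simp: S_def intro: holomorphic_on_subset[OF F] g(1))
    have wa: "w a = \<zeta>" using \<zeta> n\<zeta> \<rho> g(3) by (simp add: w_def)
    have w0: "w 0 = 0" using g(3)[of 0] by (simp add: w_def eq0)
    have wlt: "norm (w x) \<le> norm (w a)" if "norm x < norm a" for x
      using inside[OF that] g(3) \<rho> n\<zeta> by (force simp: w_def wa[unfolded w_def])
    have "w a \<noteq> 0" using wa n\<zeta> \<open>\<rho> > 0\<close> by auto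
    obtain m where m: "m \<ge> 1" "a * deriv w a = of_real m * w a"
      using jack_lemma[OF w S aS w0 \<open>a \<noteq> 0\<close> \<open>w a \<noteq> 0\<close> wlt] by blast
    have aS': "a \<in> S" using aS by auto
    have \<zeta>D: "\<zeta> \<in> \<D>" using n\<zeta> \<rho> by simp
    have GwF: "G (w x) = F x" if "x \<in> S" for x
      using that g(3) by (auto simp: S_def w_def)
    have "(G has_field_derivative deriv G \<zeta>) (at (w a))"
      using hG \<zeta>D wa by (auto intro: holomorphic_derivI)
    moreover have "(w has_field_derivative deriv w a) (at a)"
      using w S aS' by (auto intro: holomorphic_derivI)
    ultimately have "((\<lambda>x. G (w x)) has_field_derivative deriv G \<zeta> * deriv w a) (at a)"
      by (intro DERIV_chain') auto
    then have "(F has_field_derivative deriv G \<zeta> * deriv w a) (at a)"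
      by (rule has_field_derivative_transform_within_open[OF _ S aS']) (rule GwF)
    then have "a * deriv F a = of_real m * (\<zeta> * deriv G \<zeta>)"
      using m(2) wa by (simp add: DERIV_imp_deriv algebra_simps)
    then show False
      using no_contact[of a \<zeta> m] \<zeta> n\<zeta> \<rho> m az z by auto
  qed
  have FG: "F z \<in> G ` \<D>" if "z \<in> \<D>" for z
  proof -
    have "norm z < 1" using that by simp
    then obtain \<rho> where "norm z < \<rho>" "\<rho> < 1" using dense by blast
    then show ?thesis using in_image[of \<rho> z] by fastforce
  qed
  define w where "w = (\<lambda>x. g (F x))"
  have "w holomorphic_on \<D>"
    unfolding w_def by (rule holomorphic_on_compose_gen[of F _ g "G ` \<D>", unfolded o_def]) (use F g(1) FG in auto)
  \<comment> \<open>|w z| is below every \<rho> between |z| and 1; let \<rho> tend to |z|.\<close>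
  moreover have "norm (w z) \<le> norm z" if z: "z \<in> \<D>" for z
  proof (rule dense_ge_bounded[of "norm z" 1])
    fix \<rho> assume \<rho>: "norm z < \<rho>" "\<rho> < 1"
    then obtain x where "norm x < \<rho>" "F z = G x" using in_image[of \<rho> z] by fastforce
    then show "norm (w z) \<le> \<rho>" using g(3)[of x] \<rho> by (simp add: w_def)
  qed (use z in auto)
  moreover have "F z = G (w z)" if "z \<in> \<D>" for z
    using FG[OF that] g(3) by (auto simp: w_def)
  ultimately show ?thesis
    unfolding subordinate_def using F hG by blast
qed

subsection \<open>Convexity from the differential equation\<close>

text \<open>The automorphism (u - a) / (1 - a u) moves the value at 0 to 0, where Jack's lemma gives
  a factor k at least 1. Transforming back gives m = k |u(w) - a|^2 / (1 - a^2), and |u(w) - a| is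
  at least 1 - |a|.\<close>

lemma boundary_schwarz:
  fixes u :: "complex \<Rightarrow> complex" and a :: real
  assumes u: "u holomorphic_on \<D>" and u0: "u 0 = of_real a" and a: "\<bar>a\<bar> < 1"
    and w: "w \<in> \<D>" "w \<noteq> 0" and uw: "norm (u w) = 1"
    and le: "\<And>x. norm x \<le> norm w \<Longrightarrow> norm (u x) \<le> 1"
  obtains m where "m \<ge> (1 - \<bar>a\<bar>) / (1 + \<bar>a\<bar>)" "w * deriv u w = of_real m * u w"
proof -
  have a2: "a\<^sup>2 < 1" using a by (simp add: abs_square_less_1)
  \<comment> \<open>Beyond the radius |w| the modulus of u is not controlled, so the zeros of the
    denominator are cut out.\<close>
  define S where "S = \<D> \<inter> (\<lambda>x. 1 - of_real a * u x) -` (- {0})"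
  have "continuous_on \<D> (\<lambda>x. 1 - of_real a * u x)"
    by (intro continuous_intros holomorphic_on_imp_continuous_on u)
  then have S: "open S"
    unfolding S_def by (intro continuous_open_preimage) auto
  have nz: "1 - of_real a * v \<noteq> 0" if "norm v \<le> 1" for v :: complex
  proof
    assume "1 - of_real a * v = 0"
    then have "norm (of_real a * v) = 1" by (metis eq_iff_diff_eq_0 norm_one)
    moreover have "\<bar>a\<bar> * norm v \<le> \<bar>a\<bar>" using that by (simp add: mult_left_le)
    ultimately show False using a by (simp add: norm_mult)
  qed
  have sub: "cball 0 (norm w) \<subseteq> S"
    using w le nz by (auto simp: S_def)
  define U where "U = (\<lambda>x. (u x - of_real a) / (1 - of_real a * u x))"
  have U: "U holomorphic_on S"
    unfolding U_def S_def by (intro holomorphic_intros holomorphic_on_subset[OF u]) auto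
  have diff: "(norm (1 - of_real a * v))\<^sup>2 - (norm (v - of_real a))\<^sup>2 = (1 - a\<^sup>2) * (1 - (norm v)\<^sup>2)" for v :: complex
    unfolding cmod_power2 by (simp add: power2_eq_square algebra_simps)
  have eq: "norm (1 - of_real a * u w) = norm (u w - of_real a)"
    using diff[of "u w"] uw by simp
  have Uw: "norm (U w) = 1"
  proof -
    have "norm (1 - of_real a * u w) \<noteq> 0" using nz[of "u w"] uw by simp
    then show ?thesis unfolding U_def norm_divide eq[symmetric] by simp
  qed
  have Ule: "norm (U x) \<le> norm (U w)" if "norm x < norm w" for x
  proof -
    have "norm (u x) \<le> 1" using le[of x] that by simp
    then have "(1 - a\<^sup>2) * (1 - (norm (u x))\<^sup>2) \<ge> 0"
      using a2 by (intro mult_nonneg_nonneg) (auto simp: power_le_one)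
    then have "(norm (u x - of_real a))\<^sup>2 \<le> (norm (1 - of_real a * u x))\<^sup>2"
      using diff[of "u x"] by linarith
    then have "norm (u x - of_real a) \<le> norm (1 - of_real a * u x)"
      by (rule power2_le_imp_le) simp
    then show ?thesis
      unfolding Uw using nz[OF \<open>norm (u x) \<le> 1\<close>] by (simp add: U_def norm_divide)
  qed
  have "U w \<noteq> 0" using Uw by auto
  obtain k where k: "k \<ge> 1" "w * deriv U w = of_real k * U w"
    by (rule jack_lemma[OF U S sub _ w(2) \<open>U w \<noteq> 0\<close> Ule]) (auto simp: U_def u0)
  have u': "(u has_field_derivative deriv u w) (at w)"
    using u w by (intro holomorphic_derivI) auto
  have nzw: "1 - of_real a * u w \<noteq> 0" using nz uw by simp
  have "(U has_field_derivative deriv u w * (1 - (of_real a)\<^sup>2) / (1 - of_real a * u w)\<^sup>2) (at w)"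
    unfolding U_def using nzw
    by (auto intro!: derivative_eq_intros u' simp: power2_eq_square algebra_simps)
  then have "w * (deriv u w * (1 - (of_real a)\<^sup>2) / (1 - of_real a * u w)\<^sup>2) = of_real k * U w"
    using k(2) by (simp add: DERIV_imp_deriv)
  then have e1: "w * deriv u w * of_real (1 - a\<^sup>2) = of_real k * ((u w - of_real a) * (1 - of_real a * u w))"
  proof -
    have "x * b = k' * (e * d)" if "x * b / d\<^sup>2 = k' * (e / d)" "d \<noteq> 0" for x b k' e d :: complex
      using that by (simp add: field_simps power2_eq_square)
    from this[OF _ nzw] show ?thesis
      using \<open>w * (deriv u w * _ / _) = _\<close> by (simp add: U_def mult.assoc)
  qed
  \<comment> \<open>Replacing 1 by u cnj u turns (u - a) (1 - a u) into u |u - a|^2, a real multiple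
    of u.\<close>
  have "u w * cnj (u w) = 1" using uw by (simp add: complex_norm_square[symmetric])
  then have "(u w - of_real a) * (1 - of_real a * u w) = (u w - of_real a) * (u w * cnj (u w) - of_real a * u w)"
    by simp
  also have "\<dots> = u w * ((u w - of_real a) * cnj (u w - of_real a))"
    by (simp add: algebra_simps)
  also have "\<dots> = u w * of_real ((norm (u w - of_real a))\<^sup>2)"
    by (simp only: complex_norm_square)
  finally have e2: "w * deriv u w * of_real (1 - a\<^sup>2) = of_real (k * (norm (u w - of_real a))\<^sup>2) * u w"
    using e1 by simp
  have solve: "x = of_real (r / t) * v" if "x * of_real t = of_real r * v" "t \<noteq> 0" for x v :: complex and r t :: real
    using that by (simp add: field_simps)
  have e3: "w * deriv u w = of_real (k * (norm (u w - of_real a))\<^sup>2 / (1 - a\<^sup>2)) * u w"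
    by (rule solve[OF e2]) (use a2 in auto)
  have "1 - \<bar>a\<bar> \<le> norm (u w - of_real a)"
    using norm_triangle_ineq2[of "u w" "of_real a"] uw by simp
  then have "(1 - \<bar>a\<bar>)\<^sup>2 \<le> (norm (u w - of_real a))\<^sup>2"
    using a by (intro power_mono) auto
  also have "\<dots> \<le> k * (norm (u w - of_real a))\<^sup>2"
    using k(1) by (simp add: mult_le_cancel_right1)
  finally have "(1 - \<bar>a\<bar>)\<^sup>2 / (1 - a\<^sup>2) \<le> k * (norm (u w - of_real a))\<^sup>2 / (1 - a\<^sup>2)"
    using a2 by (intro divide_right_mono) auto
  moreover have "(1 - \<bar>a\<bar>)\<^sup>2 / (1 - a\<^sup>2) = (1 - \<bar>a\<bar>) / (1 + \<bar>a\<bar>)"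
  proof -
    have "1 - a\<^sup>2 = (1 - \<bar>a\<bar>) * (1 + \<bar>a\<bar>)" by (simp add: algebra_simps power2_eq_square)
    then show ?thesis using a by (simp add: power2_eq_square)
  qed
  ultimately show ?thesis by (intro that[OF _ e3]) simp
qed

text \<open>With R = 1 + z \<omega>''/\<omega>', the function u satisfies the linear equation z u' =
  2 \<beta> - (\<beta> + R) (1 + u). At a first point with |u| = 1, \<open>boundary_schwarz\<close>
  gives z u' = m u with m at least min(\<beta>, 1/\<beta>); the equation then yields 2 Re R = -m,
  against Re R > -\<gamma>.\<close>

lemma convex_map_of_ode:
  fixes \<beta> \<gamma> :: real
  assumes q: "q holomorphic_on \<D>" and \<beta>: "\<beta> > 0"
    and \<gamma>: "\<gamma> \<le> min \<beta> (1 / \<beta>) / 2"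
    and ode: "\<And>z. z \<in> \<D> \<Longrightarrow> \<omega> z = radial_chain q (1 / \<beta>) z"
    and \<omega>: "\<And>z. z \<in> \<D> \<Longrightarrow> deriv \<omega> z \<noteq> 0"
      "\<And>z. z \<in> \<D> \<Longrightarrow> Re (z * deriv (deriv \<omega>) z / deriv \<omega> z + 1) > - \<gamma>"
  shows "convex_map q"
proof -
  have q': "deriv q holomorphic_on \<D>" using q by (rule holomorphic_deriv) auto
  have hol\<omega>: "\<omega> holomorphic_on \<D>"
  proof (rule holomorphic_transform)
    show "radial_chain q (1 / \<beta>) holomorphic_on \<D>"
      unfolding radial_chain_def by (intro holomorphic_intros q q')
  qed (simp add: ode)
  define R where "R = (\<lambda>z. z * deriv (deriv \<omega>) z / deriv \<omega> z + 1)"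
  define y where "y = (\<lambda>z. deriv q z / deriv \<omega> z)"
  \<comment> \<open>\<open>y\<close> is holomorphic although \<open>q'\<close> might still vanish, and \<open>|u| < 1\<close> is equivalent to
    \<open>y \<noteq> 0\<close> and \<open>Re (\<beta> / y - \<beta>) > 0\<close>, where \<open>\<beta> / y - \<beta> = 1 + z q'' / q'\<close>\<close>
  define u where "u = (\<lambda>z. 2 * y z - 1)"
  have hol_y: "y holomorphic_on \<D>"
    unfolding y_def using \<omega>(1) by (intro holomorphic_intros q hol\<omega>) auto
  then have hol_u: "u holomorphic_on \<D>"
    unfolding u_def by (intro holomorphic_intros)
  have d\<omega>: "of_real \<beta> * deriv \<omega> z = (of_real \<beta> + 1) * deriv q z + z * deriv (deriv q) z" if z: "z \<in> \<D>" for z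
  proof -
    have d: "(q has_field_derivative deriv q z) (at z)" "(deriv q has_field_derivative deriv (deriv q) z) (at z)"
      using q q' z by (auto intro: holomorphic_derivI)
    have "(radial_chain q (1 / \<beta>) has_field_derivative
        deriv q z + of_real (1 / \<beta>) * (deriv q z + z * deriv (deriv q) z)) (at z)"
      unfolding radial_chain_def using \<beta> by (auto intro!: derivative_eq_intros d)
    then have "(\<omega> has_field_derivative
        deriv q z + of_real (1 / \<beta>) * (deriv q z + z * deriv (deriv q) z)) (at z)"
      by (rule has_field_derivative_transform_within_open[OF _ open_ball z]) (simp add: ode)
    then have "deriv \<omega> z = deriv q z + of_real (1 / \<beta>) * (deriv q z + z * deriv (deriv q) z)"
      by (rule DERIV_imp_deriv)
    then show ?thesis using \<beta> by (simp add: field_simps)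
  qed
  have u_ode: "z * deriv u z = 2 * of_real \<beta> - (of_real \<beta> + R z) * (1 + u z)" if z: "z \<in> \<D>" for z
  proof -
    have d: "(deriv q has_field_derivative deriv (deriv q) z) (at z)"
      "(deriv \<omega> has_field_derivative deriv (deriv \<omega>) z) (at z)"
      using q' holomorphic_deriv[OF hol\<omega>] z by (auto intro: holomorphic_derivI)
    have "(u has_field_derivative 2 * ((deriv (deriv q) z * deriv \<omega> z - deriv q z * deriv (deriv \<omega>) z) / (deriv \<omega> z * deriv \<omega> z))) (at z)"
      unfolding u_def y_def using \<omega>(1)[OF z] by (auto intro!: derivative_eq_intros d)
    then have "z * deriv u z = 2 * (((z * deriv (deriv q) z) * deriv \<omega> z - deriv q z * (z * deriv (deriv \<omega>) z)) / (deriv \<omega> z * deriv \<omega> z))"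
      by (simp add: DERIV_imp_deriv algebra_simps)
    also have "z * deriv (deriv q) z = of_real \<beta> * deriv \<omega> z - (of_real \<beta> + 1) * deriv q z"
      using d\<omega>[OF z] by simp
    finally show ?thesis
      using \<omega>(1)[OF z] by (simp add: u_def y_def R_def field_simps)
  qed
  \<comment> \<open>This is u(0): at the origin the differentiated equation gives q'/\<omega>' =
    \<beta> / (\<beta> + 1). The constant of \<open>boundary_schwarz\<close> for this a is
    min(\<beta>, 1/\<beta>).\<close>
  define a where "a = (\<beta> - 1) / (\<beta> + 1)"
  have a: "\<bar>a\<bar> < 1" using \<beta> by (simp add: a_def abs_less_iff field_simps)
  have a_min: "(1 - \<bar>a\<bar>) / (1 + \<bar>a\<bar>) = min \<beta> (1 / \<beta>)"
  proof (cases "\<beta> \<ge> 1")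
    case True
    then have "1 / \<beta> \<le> 1" by simp
    then have "min \<beta> (1 / \<beta>) = 1 / \<beta>" using True by linarith
    moreover have "\<bar>a\<bar> = (\<beta> - 1) / (\<beta> + 1)" using True by (simp add: a_def)
    moreover have "1 - (\<beta> - 1) / (\<beta> + 1) = 2 / (\<beta> + 1)" "1 + (\<beta> - 1) / (\<beta> + 1) = 2 * \<beta> / (\<beta> + 1)"
      using \<beta> by (simp_all add: field_simps)
    moreover have "(2 / x) / (2 * \<beta> / x) = 1 / \<beta>" if "x \<noteq> 0" for x
      using that by simp
    from this[of "\<beta> + 1"] have "(2 / (\<beta> + 1)) / (2 * \<beta> / (\<beta> + 1)) = 1 / \<beta>"
      using \<beta> by linarith
    ultimately show ?thesis by (simp only:)
  next
    case False
    then have "1 / \<beta> \<ge> 1" using \<beta> by simp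
    then have "min \<beta> (1 / \<beta>) = \<beta>" using False by linarith
    moreover have "\<bar>a\<bar> = (1 - \<beta>) / (\<beta> + 1)" using False \<beta> by (simp add: a_def abs_if field_simps)
    moreover have "1 - (1 - \<beta>) / (\<beta> + 1) = 2 * \<beta> / (\<beta> + 1)" "1 + (1 - \<beta>) / (\<beta> + 1) = 2 / (\<beta> + 1)"
      using \<beta> by (simp_all add: field_simps)
    ultimately show ?thesis using \<beta> by simp
  qed
  have u0: "u 0 = of_real a"
  proof -
    have "of_real \<beta> * deriv \<omega> 0 = (of_real \<beta> + 1) * deriv q 0"
      using d\<omega>[of 0] by simp
    then have "y 0 = of_real (\<beta> / (\<beta> + 1))"
      using \<omega>(1)[of 0] \<beta> of_real_eq_iff[of "\<beta> + 1" 0, where 'a = complex] by (simp add: y_def field_simps)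
    also have "2 * \<dots> - 1 = of_real (2 * (\<beta> / (\<beta> + 1)) - 1)" by simp
    also have "2 * (\<beta> / (\<beta> + 1)) - 1 = a" using \<beta> by (simp add: a_def field_simps)
    finally show ?thesis by (simp add: u_def)
  qed
  have u_lt: "norm (u z) < 1" if z: "z \<in> \<D>" for z
  proof (rule ccontr)
    assume neg: "\<not> norm (u z) < 1"
    obtain w where w: "w \<in> \<D>" "w \<noteq> 0" "norm (u w) - 1 = 0"
      and le: "\<And>x. norm x \<le> norm w \<Longrightarrow> norm (u x) - 1 \<le> 0"
    proof (rule first_touch[of "\<lambda>x. norm (u x) - 1" z])
      show "continuous_on \<D> (\<lambda>x. norm (u x) - 1)"
        by (intro continuous_intros holomorphic_on_imp_continuous_on hol_u)
    qed (use z neg u0 a in auto)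
    have uw: "norm (u w) = 1" and u_le: "\<And>x. norm x \<le> norm w \<Longrightarrow> norm (u x) \<le> 1"
      using w(3) le by (auto simp: algebra_simps)
    obtain m where m: "m \<ge> min \<beta> (1 / \<beta>)" "w * deriv u w = of_real m * u w"
      by (rule boundary_schwarz[OF hol_u u0 a w(1,2) uw u_le, unfolded a_min])
    have "min \<beta> (1 / \<beta>) > 0" using \<beta> by simp
    then have mpos: "m > 0" using m(1) by linarith
    define v where "v = u w"
    have vv: "v * cnj v = 1" using w(3) by (simp add: v_def complex_norm_square[symmetric])
    have e: "of_real m * v = of_real \<beta> * (1 - v) - R w * (1 + v)"
      using u_ode[OF w(1)] m(2) by (simp add: v_def algebra_simps)
    \<comment> \<open>Multiplication by 1 + cnj v makes the factor of R real, and cnj v - v is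
      purely imaginary, so the \<beta> term drops out of the real part.\<close>
    have "R w * (1 + v) = of_real \<beta> * (1 - v) - of_real m * v"
      using e by (simp add: algebra_simps)
    then have "R w * ((1 + v) * (1 + cnj v)) = (of_real \<beta> * (1 - v) - of_real m * v) * (1 + cnj v)"
      by (simp only: mult.assoc[symmetric])
    also have "\<dots> = of_real \<beta> * (1 - v * cnj v + cnj v - v) - of_real m * (v + v * cnj v)"
      by (simp add: algebra_simps)
    also have "\<dots> = of_real \<beta> * (cnj v - v) - of_real m * (v + 1)" by (simp add: vv)
    also have "(1 + v) * (1 + cnj v) = 1 + v * cnj v + (v + cnj v)" by (simp add: algebra_simps)
    also have "\<dots> = of_real (2 * (1 + Re v))" by (simp add: vv complex_add_cnj)
    finally have "Re (R w * of_real (2 * (1 + Re v))) = Re (of_real \<beta> * (cnj v - v) - of_real m * (v + 1))"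
      by simp
    then have ReR: "2 * Re (R w) * (1 + Re v) = - m * (1 + Re v)"
      by (simp add: algebra_simps)
    show False
    proof (cases "1 + Re v = 0")
      \<comment> \<open>On the unit circle this means v = -1, where the real-part identity is void;
        the equation itself gives -m = 2 \<beta>, impossible by sign.\<close>
      case True
      then have "Re v = - 1" by simp
      moreover have "(Re v)\<^sup>2 + (Im v)\<^sup>2 = 1" using w(3) by (simp add: v_def cmod_power2[symmetric])
      ultimately have "v = - 1" by (simp add: complex_eq_iff)
      then have "of_real (- m) = (of_real (2 * \<beta>) :: complex)" using e by simp
      then have "- m = 2 * \<beta>" unfolding of_real_eq_iff .
      then show False using mpos \<beta> by simp
    next
      case False
      then have "2 * Re (R w) = - m" using ReR mult_right_cancel[OF False] by blast
      then show False using \<omega>(2)[OF w(1)] m(1) \<gamma> by (simp add: R_def)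
    qed
  qed
  have "deriv q z \<noteq> 0 \<and> Re (1 + z * deriv (deriv q) z / deriv q z) > 0" if z: "z \<in> \<D>" for z
  proof -
    have "y z \<noteq> 0" using u_lt[OF z] by (auto simp: u_def)
    then have nz: "deriv q z \<noteq> 0" by (auto simp: y_def)
    \<comment> \<open>|2 y - 1| < 1 means |y|^2 < Re y, that is, Re (1/y) > 1.\<close>
    have "(norm (u z))\<^sup>2 < 1" using u_lt[OF z] by (simp add: abs_square_less_1)
    then have "(2 * Re (y z) - 1)\<^sup>2 + (2 * Im (y z))\<^sup>2 < 1" by (simp add: u_def cmod_power2)
    then have "(norm (y z))\<^sup>2 < Re (y z)" unfolding cmod_power2 by (simp add: power2_eq_square algebra_simps)
    moreover have "(norm (y z))\<^sup>2 > 0" using \<open>y z \<noteq> 0\<close> by simp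
    ultimately have "Re (1 / y z) > 1"
      by (simp add: Re_divide cmod_power2)
    then have "\<beta> * Re (1 / y z) > \<beta>" using \<beta> by simp
    moreover have "1 + z * deriv (deriv q) z / deriv q z = of_real \<beta> * (1 / y z) - of_real \<beta>"
      using d\<omega>[OF z] nz \<omega>(1)[OF z] by (simp add: y_def field_simps)
    moreover have "Re (of_real \<beta> * x - of_real \<beta>) = \<beta> * Re x - \<beta>" for x
      by simp
    ultimately show ?thesis using nz by (simp only:) simp
  qed
  then show ?thesis using q by (simp add: convex_map_def)
qed

text \<open>With \<beta> = \<mu> + 1, the root dominates both 1 and \<beta>^2, so the numerator is
  at most min(1, \<beta>^2), and min(1, \<beta>^2) / \<beta> = min(\<beta>, 1/\<beta>). This is the
  form \<open>convex_map_of_ode\<close> asks for.\<close>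

lemma gamma_bound_le:
  assumes "\<mu> > -1"
  shows "gamma_bound \<mu> \<le> min (\<mu> + 1) (1 / (\<mu> + 1)) / 2"
proof -
  define \<beta> where "\<beta> = \<mu> + 1"
  have \<beta>: "\<beta> > 0" using assms by (simp add: \<beta>_def)
  have "\<beta>\<^sup>2 \<le> sqrt (1 + \<beta> ^ 4)"
    by (rule real_le_rsqrt) simp
  moreover have "1 \<le> sqrt (1 + \<beta> ^ 4)" by simp
  ultimately have "1 + \<beta>\<^sup>2 - sqrt (1 + \<beta> ^ 4) \<le> min 1 (\<beta>\<^sup>2)" by linarith
  then have "gamma_bound \<mu> \<le> min 1 (\<beta>\<^sup>2) / (4 * \<beta>)"
    using \<beta> unfolding gamma_bound_def \<beta>_def[symmetric] by (intro divide_right_mono) auto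
  also have "\<dots> \<le> min 1 (\<beta>\<^sup>2) / (2 * \<beta>)"
    using \<beta> by (intro divide_left_mono) auto
  also have "\<dots> = min \<beta> (1 / \<beta>) / 2"
    using \<beta> by (auto simp: min_def field_simps power2_eq_square)
  finally show ?thesis by (simp add: \<beta>_def)
qed

subsection \<open>The operators on power series\<close>

text \<open>Comparison test. It serves for both operators, which multiply the coefficients by
  bounded sequences.\<close>

lemma fps_conv_radius_mono_norm:
  fixes A B :: "complex fps"
  assumes "\<And>n. norm (fps_nth B n) \<le> K * norm (fps_nth A n)"
  shows "fps_conv_radius B \<ge> fps_conv_radius A"
  unfolding fps_conv_radius_def
proof (rule conv_radius_geI_ex')
  fix r :: real assume r: "0 < r" "ereal r < conv_radius (fps_nth A)"
  have "summable (\<lambda>n. norm (fps_nth A n * of_real r ^ n))"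
    using r by (intro abs_summable_in_conv_radius) auto
  then have "summable (\<lambda>n. K * norm (fps_nth A n * of_real r ^ n))"
    by (rule summable_mult)
  then show "summable (\<lambda>n. fps_nth B n * of_real r ^ n)"
  proof (rule summable_comparison_test[rotated])
    have "norm (fps_nth B n * of_real r ^ n) \<le> K * norm (fps_nth A n * of_real r ^ n)" for n
      using mult_right_mono[OF assms[of n], of "r ^ n"] r by (simp add: norm_mult norm_power mult.assoc)
    then show "\<exists>N. \<forall>n\<ge>N. norm (fps_nth B n * of_real r ^ n) \<le> K * norm (fps_nth A n * of_real r ^ n)"
      by blast
  qed
qed

lemma disc_less_conv_radius:
  assumes "z \<in> \<D>" "fps_conv_radius A \<ge> 1"
  shows "ereal (norm z) < fps_conv_radius A"
  by (rule less_le_trans[OF _ assms(2)]) (use assms(1) in \<open>simp add: one_ereal_def\<close>)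

text \<open>Turns coefficient identities with factor a + b n into differential equations in z
  d/dz.\<close>

lemma eval_fps_euler:
  fixes B :: "complex fps"
  assumes z: "ereal (norm z) < fps_conv_radius B"
  shows "eval_fps (fps_const a * B + fps_const b * (fps_X * fps_deriv B)) z =
           a * eval_fps B z + b * (z * deriv (eval_fps B) z)"
proof -
  have d: "ereal (norm z) < fps_conv_radius (fps_deriv B)"
    using z fps_conv_radius_deriv[of B] by (rule less_le_trans)
  have X: "ereal (norm z) < fps_conv_radius (fps_X * fps_deriv B)"
    using d fps_conv_radius_mult[of fps_X "fps_deriv B"] by (auto intro: less_le_trans)
  have "ereal (norm z) < fps_conv_radius (fps_const a * B)"
    "ereal (norm z) < fps_conv_radius (fps_const b * (fps_X * fps_deriv B))"
    using z X fps_conv_radius_mult[of "fps_const a" B] 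
      fps_conv_radius_mult[of "fps_const b" "fps_X * fps_deriv B"] by (auto intro: less_le_trans)
  moreover have "deriv (eval_fps B) z = eval_fps (fps_deriv B) z"
    using z by (intro DERIV_imp_deriv has_field_derivative_eval_fps)
  ultimately show ?thesis
    using z d X by (simp add: eval_fps_add eval_fps_mult)
qed

text \<open>The multiplier by which the Bessel operator acts on the coefficient of z^(n+1).\<close>

definition bessel_weight :: "complex \<Rightarrow> complex \<Rightarrow> nat \<Rightarrow> complex" where
  "bessel_weight \<nu> c n = (- c / 4) ^ n / (pochhammer \<nu> n * fact n)"

lemma bessel_weight_bounded:
  obtains K where "\<And>n. norm (bessel_weight \<nu> c n) \<le> K"
proof -
  \<comment> \<open>From N on, |\<nu> + n| is at least |c| + 1, so the quotient (-c/4) / ((\<nu> +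
    n)(n + 1)) of successive weights has modulus at most 1/2.\<close>
  obtain N :: nat where N: "norm \<nu> + norm c + 1 \<le> real N"
    using real_arch_simple by blast
  have "summable (bessel_weight \<nu> c)"
  proof (rule summable_ratio_test)
    fix n assume "N \<le> n"
    then have n: "norm \<nu> + norm c + 1 \<le> real n" using N by linarith
    have "real n - norm \<nu> \<le> norm (\<nu> + of_nat n)"
      using norm_diff_ineq[of "of_nat n" \<nu>] by (simp add: add.commute)
    then have "norm c + 1 \<le> norm (\<nu> + of_nat n)" using n by linarith
    also have "\<dots> \<le> norm (\<nu> + of_nat n) * real (Suc n)"
      by (simp add: mult_le_cancel_left1)
    finally have D: "norm c + 1 \<le> norm (\<nu> + of_nat n) * real (Suc n)" .
    have "norm (c / 4) / (norm (\<nu> + of_nat n) * real (Suc n)) \<le> norm (c / 4) / (norm c + 1)"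
    proof (intro divide_left_mono)
      have "0 < norm c + 1" by (simp add: add_nonneg_pos)
      moreover have "0 < norm (\<nu> + of_nat n) * real (Suc n)"
        using D calculation by linarith
      ultimately show "0 < norm (\<nu> + of_nat n) * real (Suc n) * (norm c + 1)"
        by (intro mult_pos_pos[of "norm (\<nu> + of_nat n) * real (Suc n)"])
    qed (use D in auto)
    also have "\<dots> \<le> 1 / 2"
      by (simp add: norm_divide divide_simps add_nonneg_eq_0_iff) (smt (verit) norm_ge_zero)
    finally have r: "norm (c / 4) / (norm (\<nu> + of_nat n) * real (Suc n)) \<le> 1 / 2" .
    have "d ^ Suc n / (pochhammer \<nu> n * (\<nu> + of_nat n) * (of_nat (Suc n) * fact n)) =
        d / ((\<nu> + of_nat n) * of_nat (Suc n)) * (d ^ n / (pochhammer \<nu> n * fact n))" for d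
      by (simp add: mult_ac del: of_nat_Suc)
    then have "bessel_weight \<nu> c (Suc n) =
        (- c / 4) / ((\<nu> + of_nat n) * of_nat (Suc n)) * bessel_weight \<nu> c n"
      unfolding bessel_weight_def pochhammer_Suc fact_Suc .
    then have "norm (bessel_weight \<nu> c (Suc n)) =
        norm (c / 4) / (norm (\<nu> + of_nat n) * real (Suc n)) * norm (bessel_weight \<nu> c n)"
      by (simp only: norm_mult norm_divide norm_of_nat norm_minus_cancel)
    also have "\<dots> \<le> 1 / 2 * norm (bessel_weight \<nu> c n)"
      using r by (rule mult_right_mono) simp
    finally show "norm (bessel_weight \<nu> c (Suc n)) \<le> 1 / 2 * norm (bessel_weight \<nu> c n)" .
  qed simp
  then show ?thesis
    using summable_imp_Bseq that by (auto simp: Bseq_def)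
qed

text \<open>The series of B(f)(z)/z: division by z shifts the index, so a_(n+1) meets weight
  n.\<close>

definition bessel_fps :: "complex \<Rightarrow> complex \<Rightarrow> (complex \<Rightarrow> complex) \<Rightarrow> complex fps" where
  "bessel_fps \<nu> c f = Abs_fps (\<lambda>n. fps_nth (fps_expansion f 0) (Suc n) * bessel_weight \<nu> c n)"

lemma fps_conv_radius_expansion_disc:
  assumes "f holomorphic_on \<D>"
  shows "fps_conv_radius (fps_expansion f 0) \<ge> 1"
  using conv_radius_fps_expansion[of f 0 "ereal 1"] assms by (simp add: one_ereal_def)

lemma bessel_fps_conv_radius:
  assumes "f holomorphic_on \<D>"
  shows "fps_conv_radius (bessel_fps \<nu> c f) \<ge> 1"
proof -
  obtain K where K: "\<And>n. norm (bessel_weight \<nu> c n) \<le> K" using bessel_weight_bounded by blast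
  have "1 \<le> fps_conv_radius (fps_shift 1 (fps_expansion f 0))"
    using fps_conv_radius_expansion_disc[OF assms] by simp
  also have "\<dots> \<le> fps_conv_radius (bessel_fps \<nu> c f)"
    by (rule fps_conv_radius_mono_norm[of _ K])
      (use K in \<open>auto simp: bessel_fps_def norm_mult mult.commute[of K] intro!: mult_left_mono\<close>)
  finally show ?thesis .
qed

lemma bessel_eq_eval_fps:
  assumes hol: "f holomorphic_on \<D>" and f': "deriv f 0 = 1" and z: "z \<in> \<D>"
  shows "quot_id (bessel_op \<nu> c f) z = eval_fps (bessel_fps \<nu> c f) z"
proof -
  define b where "b = fps_nth (bessel_fps \<nu> c f)"
  have b0: "b 0 = 1"
    by (simp add: b_def bessel_fps_def bessel_weight_def fps_expansion_def f')
  show ?thesis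
  proof (cases "z = 0")
    case True
    then show ?thesis using b0 by (simp add: quot_id_def eval_fps_at_0 b_def)
  next
    case False
    have "ereal (norm z) < fps_conv_radius (bessel_fps \<nu> c f)"
      using z bessel_fps_conv_radius[OF hol, of \<nu> c] by (rule disc_less_conv_radius)
    then have sm: "summable (\<lambda>n. b n * z ^ n)"
      unfolding b_def by (rule summable_fps)
    \<comment> \<open>The head 1 is the normalisation of f and matches the separate summand z in
      \<open>bessel_op\<close>; the tail matches its sum over m.\<close>
    have "eval_fps (bessel_fps \<nu> c f) z = 1 + (\<Sum>n. b (Suc n) * z ^ Suc n)"
      using suminf_split_head[OF sm] b0 by (simp add: eval_fps_def b_def)
    moreover have "(\<Sum>m. fps_nth (fps_expansion f 0) (m + 2)
               * ((- c / 4) ^ (m + 1) / pochhammer \<nu> (m + 1)) * (z ^ (m + 2) / fact (m + 1)))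
            = (\<Sum>n. z * (b (Suc n) * z ^ Suc n))"
      by (rule suminf_cong) (simp add: b_def bessel_fps_def bessel_weight_def field_simps del: fact_Suc)
    moreover have "\<dots> = z * (\<Sum>n. b (Suc n) * z ^ Suc n)"
      using sm by (intro suminf_mult) (subst summable_Suc_iff)
    ultimately show ?thesis
      using False by (simp add: quot_id_def bessel_op_def add_divide_distrib)
  qed
qed

text \<open>For \<open>\<mu> = 0\<close> the factor at \<open>n = 0\<close> is a division by zero, harmless since the constant
  coefficient vanishes wherever this is used.\<close>

definition libera_fps :: "real \<Rightarrow> complex fps \<Rightarrow> complex fps" where
  "libera_fps \<mu> A = Abs_fps (\<lambda>n. of_real ((\<mu> + 1) / (\<mu> + real n)) * fps_nth A n)"

lemma libera_fps_conv_radius: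
  assumes "\<mu> > -1" "fps_nth A 0 = 0"
  shows "fps_conv_radius (libera_fps \<mu> A) \<ge> fps_conv_radius A"
proof (rule fps_conv_radius_mono_norm[where K = 1])
  fix n
  show "norm (fps_nth (libera_fps \<mu> A) n) \<le> 1 * norm (fps_nth A n)"
  proof (cases "n = 0")
    case False
    then have "\<bar>(\<mu> + 1) / (\<mu> + real n)\<bar> \<le> 1" using assms(1) by (simp add: divide_simps)
    then show ?thesis
      unfolding libera_fps_def fps_nth_Abs_fps norm_mult norm_of_real by (rule mult_right_mono) simp
  qed (simp add: libera_fps_def assms)
qed

text \<open>The series H satisfies \<mu> H + z H' = (\<mu> + 1) f, so s^\<mu> H(s z) is a primitive
  of the integrand times \<mu> + 1, and the fundamental theorem of calculus evaluates the
  integral.\<close>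

lemma libera_op_eq_eval_fps:
  assumes \<mu>: "\<mu> > -1" and f: "f holomorphic_on \<D>" "f 0 = 0" and z: "z \<in> \<D>"
  shows "libera_op \<mu> f z = eval_fps (libera_fps \<mu> (fps_expansion f 0)) z"
proof -
  define A where "A = fps_expansion f 0"
  define H where "H = libera_fps \<mu> A"
  have A0: "fps_nth A 0 = 0" by (simp add: A_def fps_expansion_def f)
  have "fps_conv_radius A \<ge> 1"
    unfolding A_def by (rule fps_conv_radius_expansion_disc[OF f(1)])
  then have R: "fps_conv_radius H \<ge> 1"
    using libera_fps_conv_radius[OF \<mu> A0] unfolding H_def by (rule order_trans)
  have conv: "ereal (norm x) < fps_conv_radius H" if "x \<in> \<D>" for x
    using that R by (rule disc_less_conv_radius)
  have fA: "eval_fps A x = f x" if "x \<in> \<D>" for x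
    using eval_fps_expansion'[of f 0 "ereal 1" x] that f(1) by (simp add: A_def)
  have "fps_const (of_real (\<mu> + 1)) * A = fps_const (of_real \<mu>) * H + fps_const 1 * (fps_X * fps_deriv H)"
  proof (rule fps_ext)
    fix n
    have "of_real (\<mu> + 1) * fps_nth A n = (of_real \<mu> + of_nat n) * fps_nth H n"
    proof (cases "n = 0")
      case False
      then have "\<mu> + real n \<noteq> 0" using \<mu> by linarith
      then have "(\<mu> + real n) * ((\<mu> + 1) / (\<mu> + real n)) = \<mu> + 1" by simp
      then have "of_real (\<mu> + 1) = (of_real (\<mu> + real n) * of_real ((\<mu> + 1) / (\<mu> + real n)) :: complex)"
        unfolding of_real_mult[symmetric] by simp
      then show ?thesis
        unfolding H_def libera_fps_def fps_nth_Abs_fps by (simp only: mult.assoc[symmetric] of_real_add of_real_of_nat_eq)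
    qed (simp add: A0 H_def libera_fps_def)
    then show "fps_nth (fps_const (of_real (\<mu> + 1)) * A) n =
        fps_nth (fps_const (of_real \<mu>) * H + fps_const 1 * (fps_X * fps_deriv H)) n"
      by (cases n) (simp_all add: algebra_simps)
  qed
  then have ode: "of_real (\<mu> + 1) * f x = of_real \<mu> * eval_fps H x + x * deriv (eval_fps H) x" if "x \<in> \<D>" for x
  proof -
    have "ereal (norm x) < fps_conv_radius A"
      using that \<open>fps_conv_radius A \<ge> 1\<close> by (rule disc_less_conv_radius)
    then have "eval_fps (fps_const (of_real (\<mu> + 1)) * A) x = of_real (\<mu> + 1) * f x"
      using fA[OF that] by (subst eval_fps_mult) auto
    then show ?thesis
      using eval_fps_euler[OF conv[OF that], of "of_real \<mu>" 1]
        \<open>fps_const (of_real (\<mu> + 1)) * A = _\<close> by simp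
  qed
  \<comment> \<open>For \<mu> at most 0 the factor s^\<mu> is not continuous at 0 in the required
    way. Splitting the zero off H gives s^(\<mu>+1) z K(s z), which is continuous on [0,1].\<close>
  define K where "K = fps_shift 1 H"
  have HX: "H = fps_X * K"
    unfolding K_def by (rule fps_ext) (auto simp: H_def libera_fps_def A0)
  have Kconv: "fps_conv_radius K \<ge> 1" using R by (simp add: K_def)
  have HK: "eval_fps H x = x * eval_fps K x" if "x \<in> \<D>" for x
    unfolding HX using that Kconv by (subst eval_fps_mult) (auto intro!: disc_less_conv_radius)
  have K_cont: "continuous_on \<D> (eval_fps K)"
    using Kconv by (intro holomorphic_on_imp_continuous_on holomorphic_on_eval_fps)
      (auto intro!: disc_less_conv_radius)
  have szD: "of_real s * z \<in> \<D>" if "s \<in> {0..1}" for s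
    using that z mult_left_le_one_le[of "norm z" "\<bar>s\<bar>"] by (auto simp: norm_mult intro: le_less_trans)
  define G where "G = (\<lambda>s::real. of_real (s powr (\<mu> + 1)) * (z * eval_fps K (of_real s * z)))"
  have G_eq: "G s = of_real (s powr \<mu>) * eval_fps H (of_real s * z)" if "s \<in> {0..1}" for s
    using that by (auto simp: G_def HK[OF szD[OF that]] powr_add)
  have "((\<lambda>s. of_real (\<mu> + 1) * (of_real (s powr (\<mu> - 1)) * f (of_real s * z))) has_integral (G 1 - G 0)) {0..1}"
  proof (rule fundamental_theorem_of_calculus_interior)
    show "continuous_on {0..1} G"
      unfolding G_def using \<mu> szD
      by (intro continuous_intros continuous_on_compose2[OF K_cont] continuous_on_powr') auto
    fix s :: real assume s: "s \<in> {0<..<1}"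
    then have s01: "s \<in> {0..1}" by simp
    have P: "((\<lambda>s. of_real (s powr \<mu>) :: complex) has_vector_derivative of_real (\<mu> * s powr (\<mu> - 1))) (at s)"
      using s by (intro has_vector_derivative_of_real has_real_derivative_powr) auto
    have "(eval_fps H has_field_derivative deriv (eval_fps H) (of_real s * z)) (at (of_real s * z))"
      using has_field_derivative_eval_fps[OF conv[OF szD[OF s01]]] DERIV_imp_deriv by metis
    then have "((\<lambda>x. eval_fps H (x * z)) has_field_derivative deriv (eval_fps H) (of_real s * z) * z) (at (of_real s))"
      by (intro DERIV_chain'[where g = "eval_fps H"]) (auto intro!: derivative_eq_intros)
    then have E: "((\<lambda>s::real. eval_fps H (of_real s * z)) has_vector_derivative deriv (eval_fps H) (of_real s * z) * z) (at s)"
      by (rule has_vector_derivative_real_field)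
    have sp: "s powr \<mu> = s * s powr (\<mu> - 1)" using s by (simp add: powr_diff)
    have "((\<lambda>s. of_real (s powr \<mu>) * eval_fps H (of_real s * z)) has_vector_derivative
        of_real (\<mu> + 1) * (of_real (s powr (\<mu> - 1)) * f (of_real s * z))) (at s)"
    proof -
      define x where "x = of_real s * z"
      have "of_real (\<mu> + 1) * (of_real (s powr (\<mu> - 1)) * f x) =
          of_real (s powr (\<mu> - 1)) * (of_real \<mu> * eval_fps H x + x * deriv (eval_fps H) x)"
        unfolding ode[OF szD[OF s01], folded x_def, symmetric] by (simp only: mult_ac)
      also have "\<dots> = of_real (s powr \<mu>) * (deriv (eval_fps H) x * z) + of_real (\<mu> * s powr (\<mu> - 1)) * eval_fps H x"
        by (simp add: sp x_def algebra_simps)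
      finally show ?thesis
        using has_vector_derivative_mult[OF P E] by (simp only: x_def)
    qed
    then show "(G has_vector_derivative
        of_real (\<mu> + 1) * (of_real (s powr (\<mu> - 1)) * f (of_real s * z))) (at s)"
      by (rule has_vector_derivative_transform_within_open[OF _ open_greaterThanLessThan s]) (simp add: G_eq)
  qed simp
  moreover have "G 1 = eval_fps H z" "G 0 = 0"
    using G_eq[of 1] by (auto simp: G_def)
  ultimately have "((\<lambda>s. of_real (\<mu> + 1) * (of_real (s powr (\<mu> - 1)) * f (of_real s * z))) has_integral
      eval_fps H z) {0..1}"
    by (simp only: diff_zero)
  then show ?thesis
    unfolding libera_op_def H_def A_def
    by (simp only: integral_unique Henstock_Kurzweil_Integration.integral_mult_right[symmetric])
qed

lemma libera_fps_expansion:
  assumes "\<mu> > -1" "f holomorphic_on \<D>" "f 0 = 0"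
  shows "fps_expansion (libera_op \<mu> f) 0 = libera_fps \<mu> (fps_expansion f 0)"
proof (rule fps_expansion_eqI)
  have "fps_conv_radius (libera_fps \<mu> (fps_expansion f 0)) \<ge> 1"
    using libera_fps_conv_radius[OF assms(1), of "fps_expansion f 0"] fps_conv_radius_expansion_disc[OF assms(2)]
    by (auto simp: fps_expansion_def assms(3))
  moreover have "\<forall>\<^sub>F z in nhds 0. eval_fps (libera_fps \<mu> (fps_expansion f 0)) z = libera_op \<mu> f z"
    using eventually_nhds_in_open[of \<D> 0]
    by (auto elim!: eventually_mono simp: libera_op_eq_eval_fps[OF assms])
  ultimately show "libera_op \<mu> f has_fps_expansion libera_fps \<mu> (fps_expansion f 0)"
    by (auto simp: has_fps_expansion_def less_le_trans[of _ 1])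
qed

text \<open>After the index shift the Libera multiplier at n is (\<mu> + 1) / (\<mu> + n + 1), the
  inverse of 1 + n / (\<mu> + 1), by which q + z q' / (\<mu> + 1) multiplies the coefficients of
  q.\<close>

lemma bessel_libera_ode:
  fixes \<nu> c :: complex
  assumes \<mu>: "\<mu> > -1" and f: "f \<in> class_A"
  defines "q \<equiv> quot_id (bessel_op \<nu> c (libera_op \<mu> f))"
  shows "q holomorphic_on \<D>"
    and "\<And>z. z \<in> \<D> \<Longrightarrow> quot_id (bessel_op \<nu> c f) z = radial_chain q (1 / (\<mu> + 1)) z"
proof -
  have hol: "f holomorphic_on \<D>" and f0: "f 0 = 0" "deriv f 0 = 1"
    using f by (auto simp: class_A_def univalent_def)
  define F where "F = libera_op \<mu> f"
  define B where "B = bessel_fps \<nu> c F"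
  define H where "H = libera_fps \<mu> (fps_expansion f 0)"
  have H: "fps_expansion F 0 = H"
    unfolding F_def H_def by (rule libera_fps_expansion[OF \<mu> hol f0(1)])
  have FH: "F z = eval_fps H z" if "z \<in> \<D>" for z
    unfolding F_def H_def by (rule libera_op_eq_eval_fps[OF \<mu> hol f0(1) that])
  have "fps_conv_radius H \<ge> 1"
    using libera_fps_conv_radius[OF \<mu>, of "fps_expansion f 0"] fps_conv_radius_expansion_disc[OF hol]
    by (auto simp: fps_expansion_def f0 H_def)
  then have "eval_fps H holomorphic_on \<D>"
    by (intro holomorphic_on_eval_fps) (auto intro!: disc_less_conv_radius)
  then have Fhol: "F holomorphic_on \<D>"
    by (rule holomorphic_transform) (simp add: FH)
  have "deriv F 0 = fps_nth H 1"
    unfolding H[symmetric] by (simp add: fps_expansion_def)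
  also have "\<dots> = 1"
  proof -
    have "(\<mu> + 1) / (\<mu> + real 1) = 1" using \<mu> by simp
    then show ?thesis by (simp only: H_def libera_fps_def fps_nth_Abs_fps) (simp add: fps_expansion_def f0)
  qed
  finally have F': "deriv F 0 = 1" .
  have qB: "q z = eval_fps B z" if "z \<in> \<D>" for z
    unfolding q_def F_def[symmetric] B_def by (rule bessel_eq_eval_fps[OF Fhol F' that])
  have Brad: "fps_conv_radius B \<ge> 1"
    unfolding B_def by (rule bessel_fps_conv_radius[OF Fhol])
  then have "eval_fps B holomorphic_on \<D>"
    by (intro holomorphic_on_eval_fps) (auto intro!: disc_less_conv_radius)
  then show "q holomorphic_on \<D>"
    by (rule holomorphic_transform) (simp add: qB)
  have A_eq: "bessel_fps \<nu> c f = fps_const 1 * B + fps_const (of_real (1 / (\<mu> + 1))) * (fps_X * fps_deriv B)"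
  proof (rule fps_ext)
    fix n
    have "\<mu> + real (Suc n) \<noteq> 0" "\<mu> + 1 \<noteq> 0" using \<mu> by auto
    then have "(1 + real n / (\<mu> + 1)) * ((\<mu> + 1) / (\<mu> + real (Suc n))) = 1"
    proof -
      have "1 + real n / (\<mu> + 1) = (\<mu> + real (Suc n)) / (\<mu> + 1)"
        using \<open>\<mu> + 1 \<noteq> 0\<close> by (simp add: add_divide_eq_iff add_ac)
      then show ?thesis
        unfolding \<open>1 + real n / (\<mu> + 1) = _\<close> using \<open>\<mu> + real (Suc n) \<noteq> 0\<close> \<open>\<mu> + 1 \<noteq> 0\<close> by simp
    qed
    then have one: "of_real (1 + real n / (\<mu> + 1)) * of_real ((\<mu> + 1) / (\<mu> + real (Suc n))) = (1 :: complex)"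
      unfolding of_real_mult[symmetric] by (simp only: of_real_1)
    have "fps_nth B n = of_real ((\<mu> + 1) / (\<mu> + real (Suc n))) * fps_nth (bessel_fps \<nu> c f) n"
      by (simp add: B_def bessel_fps_def H H_def libera_fps_def)
    then have "of_real (1 + real n / (\<mu> + 1)) * fps_nth B n = fps_nth (bessel_fps \<nu> c f) n"
      using one by (metis mult.assoc mult_1)
    then show "fps_nth (bessel_fps \<nu> c f) n =
        fps_nth (fps_const 1 * B + fps_const (of_real (1 / (\<mu> + 1))) * (fps_X * fps_deriv B)) n"
      by (cases n) (simp_all add: algebra_simps add_divide_distrib)
  qed
  fix z assume z: "z \<in> \<D>"
  have "deriv q z = deriv (eval_fps B) z"
    by (rule deriv_cong_ev) (use eventually_nhds_in_open[OF open_ball z] qB in \<open>auto elim!: eventually_mono\<close>)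
  moreover have "ereal (norm z) < fps_conv_radius B"
    using z Brad by (rule disc_less_conv_radius)
  ultimately show "quot_id (bessel_op \<nu> c f) z = radial_chain q (1 / (\<mu> + 1)) z"
    unfolding bessel_eq_eval_fps[OF hol f0(2) z] A_eq
    by (subst eval_fps_euler) (simp_all add: radial_chain_def qB[OF z])
qed

subsection \<open>Differential subordination and superordination\<close>

text \<open>Values on the disc suffice because |w z| is at most |z|. This allows replacing the
  functions of the theorem by chains, with which they agree there.\<close>

lemma subordinate_cong:
  fixes f F f' F' :: "complex \<Rightarrow> complex"
  assumes "\<And>z. z \<in> \<D> \<Longrightarrow> f z = f' z" "\<And>z. z \<in> \<D> \<Longrightarrow> F z = F' z"
  shows "f \<prec> F \<longleftrightarrow> f' \<prec> F'"
proof -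
  have "norm (w z) \<le> norm z \<and> f z = F (w z) \<longleftrightarrow> norm (w z) \<le> norm z \<and> f' z = F' (w z)" if "z \<in> \<D>" for w z
    using that assms(1)[of z] assms(2)[of "w z"] by (auto simp: le_less_trans)
  then have "(\<forall>z\<in>\<D>. norm (w z) \<le> norm z \<and> f z = F (w z)) \<longleftrightarrow>
      (\<forall>z\<in>\<D>. norm (w z) \<le> norm z \<and> f' z = F' (w z))" for w
    by blast
  moreover have "f holomorphic_on \<D> \<longleftrightarrow> f' holomorphic_on \<D>"
    by (rule holomorphic_cong[OF refl]) (rule assms(1))
  moreover have "F holomorphic_on \<D> \<longleftrightarrow> F' holomorphic_on \<D>"
    by (rule holomorphic_cong[OF refl]) (rule assms(2))
  ultimately show ?thesis
    unfolding subordinate_def by presburger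
qed

lemma univalent_cong:
  assumes "\<And>z. z \<in> \<D> \<Longrightarrow> f z = g z"
  shows "univalent f \<longleftrightarrow> univalent g"
proof -
  have "f holomorphic_on \<D> \<longleftrightarrow> g holomorphic_on \<D>"
    by (rule holomorphic_cong[OF refl]) (rule assms)
  moreover have "inj_on f \<D> \<longleftrightarrow> inj_on g \<D>"
    by (rule inj_on_cong) (rule assms)
  ultimately show ?thesis by (simp add: univalent_def)
qed

lemma subordinate_refl: "f holomorphic_on \<D> \<Longrightarrow> subordinate f f"
  unfolding subordinate_def by (auto intro!: exI[of _ "\<lambda>z. z"] holomorphic_intros)

lemma convex_map_univalent:
  assumes "convex_map q" shows "univalent q"
  using radial_chain_inj[OF assms, of 0] assms
  by (simp add: univalent_def convex_map_def radial_chain_def[abs_def])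

lemma radial_chain_dominant:
  fixes P q :: "complex \<Rightarrow> complex"
  assumes q: "convex_map q" and s: "s > 0" and P: "P holomorphic_on \<D>"
    and sub: "radial_chain P s \<prec> radial_chain q s"
  shows "P \<prec> q"
proof -
  from sub obtain w where "\<forall>z\<in>\<D>. norm (w z) \<le> norm z \<and> radial_chain P s z = radial_chain q s (w z)"
    unfolding subordinate_def by blast
  then have w: "norm (w z) \<le> norm z \<and> radial_chain P s z = radial_chain q s (w z)" if "z \<in> \<D>" for z
    using that by blast
  show ?thesis
  proof (rule subordinate_criterion[OF P convex_map_univalent[OF q]])
    show "P 0 = q 0" using w[of 0] by (simp add: radial_chain_def)
    fix z \<zeta> m
    assume *: "norm z < norm \<zeta>" "norm \<zeta> < 1" "P z = q \<zeta>" "m \<ge> 1"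
      "z * deriv P z = of_real m * (\<zeta> * deriv q \<zeta>)"
    have z: "z \<in> \<D>" and \<zeta>: "\<zeta> \<in> \<D>" using * by auto
    have wz: "w z \<in> \<D>" using w[OF z] z by auto
    have ms: "s \<le> m * s" using *(4) s by simp
    have "radial_chain q (m * s) \<zeta> = radial_chain P s z"
      unfolding radial_chain_def *(3,5) by simp
    also have "\<dots> = radial_chain q s (w z)" using w[OF z] by simp
    \<comment> \<open>The value at \<open>w z\<close> at time s is taken again at the later time
      \<open>m * s\<close>, no farther from the origin and thus strictly inside |\<zeta>|;
      injectivity at time \<open>m * s\<close> forbids it.\<close>
    finally obtain z' where z': "norm z' \<le> norm (w z)" "radial_chain q (m * s) z' = radial_chain q (m * s) \<zeta>"
      using radial_chain_subordinate[OF q less_imp_le[OF s] ms wz] by metis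
    have "norm z' < norm \<zeta>" using z'(1) w[OF z] *(1) by linarith
    then have "z' \<in> \<D>" using *(2) by simp
    then have "z' = \<zeta>"
      using inj_onD[OF radial_chain_inj[OF q, of "m * s"] z'(2)] \<zeta> ms s by simp
    then show False using \<open>norm z' < norm \<zeta>\<close> by simp
  qed
qed

lemma radial_chain_subordinant:
  fixes P q :: "complex \<Rightarrow> complex"
  assumes q: "convex_map q" and s: "s > 0" and P: "univalent P"
    and inj: "inj_on (radial_chain P s) \<D>"
    and sub: "radial_chain q s \<prec> radial_chain P s"
  shows "q \<prec> P"
proof -
  from sub obtain w where "\<forall>z\<in>\<D>. norm (w z) \<le> norm z \<and> radial_chain q s z = radial_chain P s (w z)"
    unfolding subordinate_def by blast
  then have w: "norm (w z) \<le> norm z \<and> radial_chain q s z = radial_chain P s (w z)" if "z \<in> \<D>" for z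
    using that by blast
  show ?thesis
  proof (rule subordinate_criterion[OF _ P])
    show "q holomorphic_on \<D>" using q by (simp add: convex_map_def)
    show "q 0 = P 0" using w[of 0] by (simp add: radial_chain_def)
    fix z \<zeta> m
    assume *: "norm z < norm \<zeta>" "norm \<zeta> < 1" "q z = P \<zeta>" "m \<ge> 1"
      "z * deriv q z = of_real m * (\<zeta> * deriv P \<zeta>)"
    have z: "z \<in> \<D>" and \<zeta>: "\<zeta> \<in> \<D>" using * by auto
    have ms: "0 \<le> s / m" "s / m \<le> s" using *(4) s by (auto simp: divide_simps)
    \<comment> \<open>Solving the contact condition for \<zeta> P'(\<zeta>) = z q'(z) / m gives the
      chain of q at the earlier time s/m, which can be moved forward to s.\<close>
    have "radial_chain P s \<zeta> = radial_chain q (s / m) z"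
      unfolding radial_chain_def *(3,5) using *(4) by simp
    then obtain z' where z': "norm z' \<le> norm z" "radial_chain q s z' = radial_chain P s \<zeta>"
      using radial_chain_subordinate[OF q ms z] by metis
    \<comment> \<open>Hence \<open>w z'\<close> and \<zeta> have the same value under the injective
      \<open>radial_chain P s\<close> but different moduli.\<close>
    have "norm (w z') < norm \<zeta>" "norm z' < 1"
      using z'(1) w[of z'] * by auto
    then have "w z' \<in> \<D>" "radial_chain P s (w z') = radial_chain P s \<zeta>"
      using *(2) w[of z'] z'(2) by auto
    then have "w z' = \<zeta>"
      using inj_onD[OF inj] \<zeta> by blast
    then show False using \<open>norm (w z') < norm \<zeta>\<close> by simp
  qed
qed

lemma best_dominant_radial_chain:
  assumes q: "convex_map q" and s: "s > 0"
    and \<phi>: "\<And>P z. diff_expr \<phi> P z = radial_chain P s z"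
    and h: "\<And>z. z \<in> \<D> \<Longrightarrow> h z = radial_chain q s z"
  shows "best_dominant \<phi> h q"
proof -
  have sol: "subordination_solution \<phi> h P \<longleftrightarrow> P holomorphic_on \<D> \<and> radial_chain P s \<prec> radial_chain q s" for P
  proof -
    have "diff_expr \<phi> P \<prec> h \<longleftrightarrow> radial_chain P s \<prec> radial_chain q s"
      by (rule subordinate_cong) (rule \<phi>, rule h)
    then show ?thesis by (simp add: subordination_solution_def)
  qed
  have "univalent h \<longleftrightarrow> univalent (radial_chain q s)"
    by (rule univalent_cong) (rule h)
  then have "univalent h"
    using radial_chain_inj[OF q] radial_chain_holomorphic[OF q] s by (simp add: univalent_def)
  \<comment> \<open>As q is itself a solution, every dominant must dominate it.\<close>
  moreover have "subordination_solution \<phi> h q"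
    unfolding sol using q radial_chain_holomorphic[OF q] by (simp add: subordinate_refl convex_map_def)
  ultimately show ?thesis
    using radial_chain_dominant[OF q s] convex_map_univalent[OF q]
    by (auto simp: best_dominant_def dominant_def sol)
qed

lemma superordination_solution_radial_chain_iff:
  assumes \<phi>: "\<And>P z. diff_expr \<phi> P z = radial_chain P s z"
    and h: "\<And>z. z \<in> \<D> \<Longrightarrow> h z = radial_chain q s z"
  shows "superordination_solution \<phi> h P \<longleftrightarrow>
    univalent P \<and> univalent (radial_chain P s) \<and> radial_chain q s \<prec> radial_chain P s"
proof -
  have "h \<prec> diff_expr \<phi> P \<longleftrightarrow> radial_chain q s \<prec> radial_chain P s"
    by (rule subordinate_cong) (rule h, assumption, rule \<phi>)
  moreover have "univalent (diff_expr \<phi> P) \<longleftrightarrow> univalent (radial_chain P s)"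
    by (rule univalent_cong) (rule \<phi>)
  ultimately show ?thesis by (simp add: superordination_solution_def)
qed

lemma best_subordinant_radial_chain:
  assumes q: "convex_map q" and s: "s > 0"
    and \<phi>: "\<And>P z. diff_expr \<phi> P z = radial_chain P s z"
    and h: "\<And>z. z \<in> \<D> \<Longrightarrow> h z = radial_chain q s z"
  shows "best_subordinant \<phi> h q"
proof -
  have sol: "superordination_solution \<phi> h P \<longleftrightarrow>
      univalent P \<and> univalent (radial_chain P s) \<and> radial_chain q s \<prec> radial_chain P s" for P
    by (rule superordination_solution_radial_chain_iff) (rule \<phi>, rule h)
  have hol: "radial_chain q s holomorphic_on \<D>" by (rule radial_chain_holomorphic[OF q])
  have "h holomorphic_on \<D>"
    by (rule holomorphic_transform[OF hol]) (simp add: h)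
  \<comment> \<open>Being a solution includes univalence of q and of its chain; every subordinant is
    then subordinate to q.\<close>
  moreover have "superordination_solution \<phi> h q"
    unfolding sol using radial_chain_inj[OF q] s hol convex_map_univalent[OF q]
    by (simp add: univalent_def subordinate_refl)
  moreover have "q \<prec> P" if "superordination_solution \<phi> h P" for P
    using that radial_chain_subordinant[OF q s, of P] by (auto simp: sol univalent_def)
  ultimately show ?thesis
    using convex_map_univalent[OF q]
    by (auto simp: best_subordinant_def subordinant_def univalent_def)
qed

theorem theorem3:
  fixes b p c \<kappa> :: complex and \<mu> :: real
    and f g\<^sub>1 g\<^sub>2 \<omega>\<^sub>1 \<omega>\<^sub>2 :: "complex \<Rightarrow> complex"
    and \<phi> :: "complex \<Rightarrow> complex \<Rightarrow> complex"
  assumes "c \<noteq> 0"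
    and kappa: "\<kappa> = p + (b + 1) / 2" "\<kappa> \<notin> \<int>\<^sub>\<le>\<^sub>0"
    and A: "f \<in> class_A" "g\<^sub>1 \<in> class_A" "g\<^sub>2 \<in> class_A"
    and omega: "\<omega>\<^sub>1 = quot_id (bessel_op \<kappa> c g\<^sub>1)" "\<omega>\<^sub>2 = quot_id (bessel_op \<kappa> c g\<^sub>2)"
    and mu: "\<mu> > -1"
    and phi: "\<phi> = (\<lambda>u v. u + 1 / (of_real \<mu> + 1) * v)"
    and omega1: "\<forall>z\<in>\<D>. deriv \<omega>\<^sub>1 z \<noteq> 0 \<and>
        Re (z * deriv (deriv \<omega>\<^sub>1) z / deriv \<omega>\<^sub>1 z + 1) > - gamma_bound \<mu>"
    and omega2: "\<forall>z\<in>\<D>. deriv \<omega>\<^sub>2 z \<noteq> 0 \<and>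
        Re (z * deriv (deriv \<omega>\<^sub>2) z / deriv \<omega>\<^sub>2 z + 1) > - gamma_bound \<mu>"
  shows "(univalent (quot_id (bessel_op \<kappa> c f)) \<and>
          quot_id (bessel_op \<kappa> c (libera_op \<mu> f)) \<in> class_H11 \<inter> class_Q \<longrightarrow>
          \<omega>\<^sub>1 \<prec> quot_id (bessel_op \<kappa> c f) \<and> quot_id (bessel_op \<kappa> c f) \<prec> \<omega>\<^sub>2 \<longrightarrow>
          quot_id (bessel_op \<kappa> c (libera_op \<mu> g\<^sub>1)) \<prec> quot_id (bessel_op \<kappa> c (libera_op \<mu> f)) \<and>
          quot_id (bessel_op \<kappa> c (libera_op \<mu> f)) \<prec> quot_id (bessel_op \<kappa> c (libera_op \<mu> g\<^sub>2)))
       \<and> best_subordinant \<phi> \<omega>\<^sub>1 (quot_id (bessel_op \<kappa> c (libera_op \<mu> g\<^sub>1)))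
       \<and> best_dominant \<phi> \<omega>\<^sub>2 (quot_id (bessel_op \<kappa> c (libera_op \<mu> g\<^sub>2)))"
proof -
  define s where "s = 1 / (\<mu> + 1)"
  define q where "q = (\<lambda>g. quot_id (bessel_op \<kappa> c (libera_op \<mu> g)))"
  have s: "s > 0" using mu by (simp add: s_def)
  have diff: "diff_expr \<phi> P z = radial_chain P s z" for P z
    by (simp add: diff_expr_def phi radial_chain_def s_def)
  have hol: "q g holomorphic_on \<D>" if "g \<in> class_A" for g
    unfolding q_def by (rule bessel_libera_ode(1)[OF mu that])
  have ode: "quot_id (bessel_op \<kappa> c g) z = radial_chain (q g) s z" if "g \<in> class_A" "z \<in> \<D>" for g z
    unfolding q_def s_def by (rule bessel_libera_ode(2)[OF mu that])
  have convex: "convex_map (q g)"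
    if g: "g \<in> class_A" and \<omega>: "\<omega> = quot_id (bessel_op \<kappa> c g)"
      and cond: "\<forall>z\<in>\<D>. deriv \<omega> z \<noteq> 0 \<and>
        Re (z * deriv (deriv \<omega>) z / deriv \<omega> z + 1) > - gamma_bound \<mu>" for g \<omega>
  proof (rule convex_map_of_ode[OF hol[OF g] _ gamma_bound_le[OF mu]])
    show "\<omega> z = radial_chain (q g) (1 / (\<mu> + 1)) z" if "z \<in> \<D>" for z
      using ode[OF g that] by (simp add: \<omega> s_def)
  qed (use mu cond in auto)
  have q1: "convex_map (q g\<^sub>1)" and q2: "convex_map (q g\<^sub>2)"
    using convex[OF A(2) omega(1) omega1] convex[OF A(3) omega(2) omega2] by simp_all
  have o1: "\<omega>\<^sub>1 z = radial_chain (q g\<^sub>1) s z" and o2: "\<omega>\<^sub>2 z = radial_chain (q g\<^sub>2) s z" if "z \<in> \<D>" for z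
    using ode[OF A(2) that] ode[OF A(3) that] by (simp_all add: omega)
  have bs: "best_subordinant \<phi> \<omega>\<^sub>1 (q g\<^sub>1)"
    using q1 s diff o1 by (rule best_subordinant_radial_chain)
  have bd: "best_dominant \<phi> \<omega>\<^sub>2 (q g\<^sub>2)"
    using q2 s diff o2 by (rule best_dominant_radial_chain)
  have "q g\<^sub>1 \<prec> q f \<and> q f \<prec> q g\<^sub>2"
    if uni: "univalent (quot_id (bessel_op \<kappa> c f))" and Q: "q f \<in> class_Q"
      and sub: "\<omega>\<^sub>1 \<prec> quot_id (bessel_op \<kappa> c f)" "quot_id (bessel_op \<kappa> c f) \<prec> \<omega>\<^sub>2"
  proof -
    note odef = ode[OF A(1)]
    \<comment> \<open>Exceptional points lie on the circle, so \<open>class_Q\<close> supplies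
      injectivity on the whole open disc.\<close>
    have "\<D> \<subseteq> cball 0 1 - exceptional_set (q f)" by (auto simp: exceptional_set_def)
    then have "univalent (q f)"
      using Q hol[OF A(1)] by (auto simp: class_Q_def univalent_def intro: inj_on_subset)
    moreover have "inj_on (radial_chain (q f) s) \<D>"
    proof -
      have "univalent (quot_id (bessel_op \<kappa> c f)) \<longleftrightarrow> univalent (radial_chain (q f) s)"
        by (rule univalent_cong) (rule odef)
      then show ?thesis using uni by (simp add: univalent_def)
    qed
    moreover have "\<omega>\<^sub>1 \<prec> quot_id (bessel_op \<kappa> c f) \<longleftrightarrow> radial_chain (q g\<^sub>1) s \<prec> radial_chain (q f) s"
      by (rule subordinate_cong) (rule o1, assumption, rule odef)
    moreover have "quot_id (bessel_op \<kappa> c f) \<prec> \<omega>\<^sub>2 \<longleftrightarrow> radial_chain (q f) s \<prec> radial_chain (q g\<^sub>2) s"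
      by (rule subordinate_cong) (rule odef, assumption, rule o2)
    ultimately show ?thesis
      using sub radial_chain_subordinant[OF q1 s] radial_chain_dominant[OF q2 s hol[OF A(1)]] by blast
  qed
  then show ?thesis
    using bs bd unfolding q_def by blast
qed

end
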